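(* Let $G$ be a graph of order $n\geq 17$. If $\rho(G)\geq \rho(K_4\bullet K_{1,n-4})$, then $G$ contains two edge-disjoint cycles unless $G\cong K_4\bullet K_{1,n-4}$.
   Context: All graphs are finite, simple and undirected. The order of a graph is its number of vertices. $\rho(G)$ denotes the spectral radius of $G$, i.e. the largest eigenvalue of its adjacency matrix. $K_r$ is the complete graph on $r$ vertices and $K_{a,b}$ is the complete bipartite graph with parts of sizes $a$ and $b$. $H\bullet K_{a,b}$ denotes the graph obtained by coalescing (identifying) a vertex of $K_{a,b}$ belonging to the part of size $a$ with a vertex of $H$, retaining all edges of $H$ and of $K_{a,b}$. Thus $K_4\bullet K_{1,n-4}$ is the $n$-vertex graph obtained from $K_4$ by attaching $n-4$ pendant vertices to one of its vertices. Two cycles are edge-disjoint if they have no common edge (they may share vertices). *)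

theory Defs
  imports "Graph_Theory.Graph_Theory" "Jordan_Normal_Form.Char_Poly"
begin

text \<open>
  A finite simple undirected graph is a \<^const>\<open>pair_graph\<close>: a finite, loop-free digraph whose arcs
  form a symmetric relation.  An edge joining \<open>u\<close> and \<open>v\<close> is represented by the two arcs \<open>(u, v)\<close>
  and \<open>(v, u)\<close>.
\<close>

definition adjacency_matrix :: "'a pair_pre_digraph \<Rightarrow> 'a list \<Rightarrow> real mat" where
  "adjacency_matrix G vs =
     mat (length vs) (length vs) (\<lambda>(i, j). if (vs ! i, vs ! j) \<in> parcs G then 1 else 0)"

definition vertex_enum :: "'a pair_pre_digraph \<Rightarrow> 'a list" where
  "vertex_enum G = (SOME vs. distinct vs \<and> set vs = pverts G)"

text \<open>
  The adjacency matrix of a finite graph is real and symmetric, so all its eigenvalues are real;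
  by \<open>eigenvalue_adjacency_matrix_iff\<close> below they do not depend on the enumeration of the vertices.
\<close>

definition graph_spectral_radius :: "'a pair_pre_digraph \<Rightarrow> real" where
  "graph_spectral_radius G = Max {k. eigenvalue (adjacency_matrix G (vertex_enum G)) k}"

text \<open>
  \<^const>\<open>pre_digraph.cycle\<close> admits the closed walk \<open>u, v, u\<close> along an arc and its reverse, which is
  not a cycle of an undirected graph; hence the bound on the length.
\<close>

definition undirected_cycle :: "'a pair_pre_digraph \<Rightarrow> ('a \<times> 'a) awalk \<Rightarrow> bool" where
  "undirected_cycle G p \<longleftrightarrow> pre_digraph.cycle (with_proj G) p \<and> 3 \<le> length p"

definition walk_edges :: "('a \<times> 'a) awalk \<Rightarrow> 'a set set" where
  "walk_edges p = (\<lambda>(u, v). {u, v}) ` set p"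

definition has_two_edge_disjoint_cycles :: "'a pair_pre_digraph \<Rightarrow> bool" where
  "has_two_edge_disjoint_cycles G \<longleftrightarrow>
     (\<exists>p q. undirected_cycle G p \<and> undirected_cycle G q \<and> walk_edges p \<inter> walk_edges q = {})"

definition graph_isomorphic :: "'a pair_pre_digraph \<Rightarrow> 'b pair_pre_digraph \<Rightarrow> bool" where
  "graph_isomorphic G H \<longleftrightarrow> digraph_iso (with_proj G) (with_proj H)"

definition complete_graph :: "nat \<Rightarrow> nat pair_pre_digraph" where
  "complete_graph r = \<lparr> pverts = {..<r}, parcs = {(u, v). u < r \<and> v < r \<and> u \<noteq> v} \<rparr>"

definition complete_bipartite_graph :: "nat \<Rightarrow> nat \<Rightarrow> (nat + nat) pair_pre_digraph" where
  "complete_bipartite_graph a b =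
     \<lparr> pverts = Inl ` {..<a} \<union> Inr ` {..<b},
       parcs = (Inl ` {..<a}) \<times> (Inr ` {..<b}) \<union> (Inr ` {..<b}) \<times> (Inl ` {..<a}) \<rparr>"

text \<open>
  The disjoint union of \<open>H\<close> and \<open>F\<close> with the vertex \<open>f\<close> of \<open>F\<close> identified with the vertex \<open>h\<close>
  of \<open>H\<close>; the identified vertex is \<open>Inl h\<close>.
\<close>

definition coalescence ::
    "'a pair_pre_digraph \<Rightarrow> 'a \<Rightarrow> 'b pair_pre_digraph \<Rightarrow> 'b \<Rightarrow> ('a + 'b) pair_pre_digraph" where
  "coalescence H h F f =
     (let \<iota> = (\<lambda>x. if x = f then Inl h else Inr x)
      in \<lparr> pverts = Inl ` pverts H \<union> \<iota> ` pverts F,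
           parcs = map_prod Inl Inl ` parcs H \<union> map_prod \<iota> \<iota> ` parcs F \<rparr>)"

text \<open>
  The graph \<open>K\<^sub>4 \<bullet> K\<^bsub>1,n-4\<^esub>\<close>.  All vertices of \<open>K\<^sub>4\<close> are equivalent under automorphisms, so the choice
  of \<open>0\<close> is immaterial; \<open>Inl 0\<close> is the only vertex in the part of size \<open>1\<close>.
\<close>

definition K4_bullet_star :: "nat \<Rightarrow> (nat + (nat + nat)) pair_pre_digraph" where
  "K4_bullet_star n =
     coalescence (complete_graph 4) 0 (complete_bipartite_graph 1 (n - 4)) (Inl 0)"


lemma vertex_enum:
  assumes "finite (pverts G)"
  shows "distinct (vertex_enum G)" "set (vertex_enum G) = pverts G"
proof -
  have "\<exists>vs. distinct vs \<and> set vs = pverts G"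
    using finite_distinct_list[OF assms] by blast
  from someI_ex[OF this] show "distinct (vertex_enum G)" "set (vertex_enum G) = pverts G"
    unfolding vertex_enum_def by blast+
qed

lemma adjacency_matrix_mult_vec:
  assumes vs: "distinct vs" "set vs = pverts G" and i: "i < length vs"
    and x: "x \<in> carrier_vec (length vs)" "\<And>j. j < length vs \<Longrightarrow> x $ j = f (vs ! j)"
  shows "(adjacency_matrix G vs *\<^sub>v x) $ i = (\<Sum>u \<in> {u \<in> pverts G. (vs ! i, u) \<in> parcs G}. f u)"
proof -
  have fin: "finite (pverts G)"
    using vs(2) by (metis List.finite_set)
  have "(adjacency_matrix G vs *\<^sub>v x) $ i =
      (\<Sum>j = 0..<length vs. (if (vs ! i, vs ! j) \<in> parcs G then 1 else 0) * x $ j)"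
    using i x(1) by (simp add: adjacency_matrix_def scalar_prod_def)
  also have "\<dots> = (\<Sum>j = 0..<length vs. if (vs ! i, vs ! j) \<in> parcs G then f (vs ! j) else 0)"
    by (rule sum.cong) (auto simp: x(2))
  also have "\<dots> = (\<Sum>u \<in> pverts G. if (vs ! i, u) \<in> parcs G then f u else 0)"
    by (rule sum.reindex_bij_betw) (use bij_betw_nth[OF vs(1) _ refl] vs(2) in \<open>simp add: lessThan_atLeast0\<close>)
  also have "\<dots> = (\<Sum>u \<in> {u \<in> pverts G. (vs ! i, u) \<in> parcs G}. f u)"
    using fin by (simp add: sum.If_cases Int_def)
  finally show ?thesis .
qed

lemma eigenvalue_adjacency_matrix_iff:
  assumes vs: "distinct vs" "set vs = pverts G"
  shows "eigenvalue (adjacency_matrix G vs) k \<longleftrightarrow>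
    (\<exists>f. (\<exists>v \<in> pverts G. f v \<noteq> 0) \<and>
         (\<forall>v \<in> pverts G. (\<Sum>u \<in> {u \<in> pverts G. (v, u) \<in> parcs G}. f u) = k * f v))"
    (is "?L \<longleftrightarrow> (\<exists>f. ?P f)")
proof
  have dim: "dim_row (adjacency_matrix G vs) = length vs"
    by (simp add: adjacency_matrix_def)
  {
    assume ?L
    then obtain x where x: "x \<in> carrier_vec (length vs)" "x \<noteq> 0\<^sub>v (length vs)"
        "adjacency_matrix G vs *\<^sub>v x = k \<cdot>\<^sub>v x"
      by (auto simp: eigenvalue_def eigenvector_def dim)
    define f where "f v = x $ (inv_into {..<length vs} ((!) vs) v)" for v
    have f: "x $ j = f (vs ! j)" if "j < length vs" for j
      using that vs(1) by (simp add: f_def inv_into_f_f inj_on_nth)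
    have "\<exists>j < length vs. x $ j \<noteq> 0"
      using x(1,2) by (auto simp: vec_eq_iff)
    then have "\<exists>v \<in> pverts G. f v \<noteq> 0"
      using f vs(2) by (metis nth_mem)
    moreover have "(\<Sum>u \<in> {u \<in> pverts G. (v, u) \<in> parcs G}. f u) = k * f v"
      if "v \<in> pverts G" for v
    proof -
      from that vs(2) obtain i where i: "i < length vs" "v = vs ! i"
        by (metis in_set_conv_nth)
      show ?thesis
        using adjacency_matrix_mult_vec[OF vs i(1) x(1) f] x(1,3) i f by simp
    qed
    ultimately show "\<exists>f. ?P f" by blast
  }
  {
    assume "\<exists>f. ?P f"
    then obtain f where f: "?P f" by blast
    define x where "x = vec (length vs) (\<lambda>j. f (vs ! j))"
    have x: "x \<in> carrier_vec (length vs)" "\<And>j. j < length vs \<Longrightarrow> x $ j = f (vs ! j)"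
      by (auto simp: x_def)
    have "x \<noteq> 0\<^sub>v (length vs)"
    proof
      assume "x = 0\<^sub>v (length vs)"
      then have "f (vs ! j) = 0" if "j < length vs" for j
        using x(2)[OF that] that by simp
      then show False using f vs(2) by (metis in_set_conv_nth)
    qed
    moreover have "adjacency_matrix G vs *\<^sub>v x = k \<cdot>\<^sub>v x"
    proof (rule eq_vecI)
      fix i assume "i < dim_vec (k \<cdot>\<^sub>v x)"
      then have i: "i < length vs" by (simp add: x_def)
      then have "vs ! i \<in> pverts G" using vs(2) by (metis nth_mem)
      then show "(adjacency_matrix G vs *\<^sub>v x) $ i = (k \<cdot>\<^sub>v x) $ i"
        using adjacency_matrix_mult_vec[OF vs i x] x i f by simp
    qed (simp add: dim x_def)
    ultimately show ?L
      using x(1) by (auto simp: eigenvalue_def eigenvector_def dim)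
  }
qed

lemma graph_spectral_radius_eq:
  assumes "distinct vs" "set vs = pverts G"
  shows "graph_spectral_radius G = Max {k. eigenvalue (adjacency_matrix G vs) k}"
proof -
  have "finite (pverts G)" using assms(2) by (metis List.finite_set)
  show ?thesis
    unfolding graph_spectral_radius_def eigenvalue_adjacency_matrix_iff[OF assms]
      eigenvalue_adjacency_matrix_iff[OF vertex_enum[OF \<open>finite (pverts G)\<close>]]
    by (rule refl)
qed

lemma complete_digraph_complete_graph: "K\<^bsub>r\<^esub> (with_proj (complete_graph r))"
  by (auto simp: complete_digraph_pair_def complete_graph_def)

lemma complete_bipartite_digraph_complete_bipartite_graph:
  "K\<^bsub>a,b\<^esub> (with_proj (complete_bipartite_graph a b))"
  unfolding complete_bipartite_digraph_pair_def complete_bipartite_graph_def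
  by (intro conjI exI[of _ "Inl ` {..<a}"] exI[of _ "Inr ` {..<b}"]) (auto simp: card_image)

lemma pair_graph_coalescence:
  assumes "pair_graph H" "pair_graph F" "h \<in> pverts H"
  shows "pair_graph (coalescence H h F f)"
proof -
  interpret H: pair_graph H by fact
  interpret F: pair_graph F by fact
  define \<iota> where "\<iota> x = (if x = f then Inl h else Inr x)" for x :: 'b
  have \<iota>_eq: "\<iota> x = \<iota> y \<longleftrightarrow> x = y" for x y
    by (auto simp: \<iota>_def)
  have eq: "coalescence H h F f = \<lparr> pverts = Inl ` pverts H \<union> \<iota> ` pverts F,
      parcs = map_prod Inl Inl ` parcs H \<union> map_prod \<iota> \<iota> ` parcs F \<rparr>"
    unfolding coalescence_def \<iota>_def[abs_def] Let_def by (rule refl)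
  show ?thesis
    unfolding eq
  proof
    fix e assume e: "e \<in> parcs \<lparr> pverts = Inl ` pverts H \<union> \<iota> ` pverts F,
      parcs = map_prod Inl Inl ` parcs H \<union> map_prod \<iota> \<iota> ` parcs F \<rparr>"
    let ?V = "pverts \<lparr> pverts = Inl ` pverts H \<union> \<iota> ` pverts F,
      parcs = map_prod Inl Inl ` parcs H \<union> map_prod \<iota> \<iota> ` parcs F \<rparr>"
    show "fst e \<in> ?V" "snd e \<in> ?V"
      using e by (auto dest: H.in_arcsD1 H.in_arcsD2 F.in_arcsD1 F.in_arcsD2)
    show "fst e \<noteq> snd e"
      using e H.no_loops' F.no_loops' by (auto simp: \<iota>_eq)
  next
    have sym_image: "sym (map_prod g g ` r)" if "sym r" for g :: "'c \<Rightarrow> 'a + 'b" and r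
    proof (rule symI)
      fix x y assume "(x, y) \<in> map_prod g g ` r"
      then obtain u v where "(u, v) \<in> r" "x = g u" "y = g v" by auto
      then show "(y, x) \<in> map_prod g g ` r"
        using symD[OF that] by (metis image_eqI map_prod_simp)
    qed
    have "sym (parcs H)" "sym (parcs F)"
      using H.pair_sym_arcs F.pair_sym_arcs by (simp_all add: symmetric_def)
    then have "sym (map_prod Inl Inl ` parcs H :: ('a + 'b) rel)" "sym (map_prod \<iota> \<iota> ` parcs F)"
      by (simp_all only: sym_image)
    then show "symmetric (with_proj \<lparr> pverts = Inl ` pverts H \<union> \<iota> ` pverts F,
      parcs = map_prod Inl Inl ` parcs H \<union> map_prod \<iota> \<iota> ` parcs F \<rparr>)"
      by (simp add: symmetric_def sym_Un)
  qed (simp_all add: H.pair_finite_verts F.pair_finite_verts H.pair_finite_arcs F.pair_finite_arcs)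
qed

lemma pair_graph_K4_bullet_star: "pair_graph (K4_bullet_star n)"
  unfolding K4_bullet_star_def
  by (intro pair_graph_coalescence pair_graphI_complete[OF complete_digraph_complete_graph]
      pair_graphI_complete_bipartite[OF complete_bipartite_digraph_complete_bipartite_graph])
    (simp add: complete_graph_def)

lemma card_pverts_K4_bullet_star:
  assumes "4 \<le> n"
  shows "card (pverts (K4_bullet_star n)) = n"
proof -
  have "pverts (K4_bullet_star n) = Inl ` {..<4} \<union> (Inr \<circ> Inr) ` {..<n - 4}"
    by (auto simp: K4_bullet_star_def coalescence_def complete_graph_def
        complete_bipartite_graph_def Let_def image_iff split: if_splits)
  moreover have "card (Inl ` {..<4::nat} \<union> (Inr \<circ> Inr) ` {..<n - 4} :: (nat + (nat + nat)) set)
      = card (Inl ` {..<4::nat} :: (nat + (nat + nat)) set)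
        + card ((Inr \<circ> Inr) ` {..<n - 4} :: (nat + (nat + nat)) set)"
    by (rule card_Un_disjoint) auto
  ultimately show ?thesis
    using assms by (simp add: card_image inj_on_def)
qed

lemma graph_isomorphic_iff:
  assumes "pair_graph G"
  shows "graph_isomorphic G H \<longleftrightarrow>
    (\<exists>f. inj_on f (pverts G) \<and> pverts H = f ` pverts G \<and> parcs H = map_prod f f ` parcs G)"
    (is "_ \<longleftrightarrow> (\<exists>f. ?P f)")
proof
  interpret pair_graph G by fact
  assume "graph_isomorphic G H"
  then obtain iso where iso: "digraph_isomorphism iso" "with_proj H = app_iso iso (with_proj G)"
    by (auto simp: graph_isomorphic_def digraph_iso_def)
  from iso(2) have H: "pverts H = iso_verts iso ` pverts G" "parcs H = iso_arcs iso ` parcs G"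
      "iso_tail iso = fst" "iso_head iso = snd"
    by (auto simp: with_proj_def app_iso_def)
  have "iso_arcs iso a = map_prod (iso_verts iso) (iso_verts iso) a" if "a \<in> parcs G" for a
    using iso(1) that H(3,4) by (auto simp: digraph_isomorphism_def prod_eq_iff)
  then have "parcs H = map_prod (iso_verts iso) (iso_verts iso) ` parcs G"
    unfolding H(2) by (rule image_cong[OF refl])
  with iso(1) H(1) show "\<exists>f. ?P f"
    by (intro exI[of _ "iso_verts iso"]) (simp add: digraph_isomorphism_def)
next
  interpret pair_graph G by fact
  assume "\<exists>f. ?P f"
  then obtain f where f: "?P f" by blast
  define iso where
    "iso = \<lparr> iso_verts = f, iso_arcs = map_prod f f, iso_head = snd, iso_tail = fst \<rparr>"
  have "inj_on (map_prod f f) (parcs G)"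
    using f in_arcsD1 in_arcsD2 by (auto simp: inj_on_def)
  then have "digraph_isomorphism iso"
    using f by (auto simp: digraph_isomorphism_def iso_def intro: wf_digraph_axioms)
  moreover have "with_proj H = app_iso iso (with_proj G)"
    using f by (simp add: with_proj_def app_iso_def iso_def)
  ultimately show "graph_isomorphic G H"
    by (auto simp: graph_isomorphic_def digraph_iso_def)
qed

end

theory Submission
  imports Defs "Jordan_Normal_Form.Spectral_Radius"
begin

text \<open>
  Let \<open>G\<close> have no two edge-disjoint cycles, let \<open>k\<close> be its spectral radius and \<open>n\<close> its order.  The
  eigenvector \<open>(1, 1/(r-2), 1/r)\<close> of \<open>K\<^sub>4 \<bullet> K\<^bsub>1,n-4\<^esub>\<close> gives \<open>k > 4\<close> and \<open>(k - 2)(k\<^sup>2 - (n - 1)) \<ge> 6\<close>.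
  Normalise the absolute value \<open>g\<close> of an eigenvector of \<open>G\<close> to have maximum \<open>g u = 1\<close>, and let \<open>N\<close> be
  the neighbourhood of \<open>u\<close>, \<open>W\<close> the set of vertices at distance at least 2 and \<open>c w\<close> the number of
  neighbours of \<open>w\<close> in \<open>N\<close>.  Counting walks of length 2 from \<open>u\<close> bounds \<open>k\<^sup>2\<close> by \<open>|N|\<close> plus
  contributions of the edges inside \<open>N\<close> and of the vertices of \<open>W\<close>; if all \<open>c w \<le> 1\<close> and \<open>N\<close> is
  independent, this already gives \<open>k\<^sup>2 \<le> n - 1\<close>.  Otherwise \<open>u\<close> lies on a cycle of length 3 or 4,
  and deleting its edges leaves a forest.  So few edges remain that a charging argument on \<open>W\<close>
  yields \<open>(k - 2)(k\<^sup>2 - (n - 1)) < 6\<close>, unless \<open>W\<close> is empty and \<open>N\<close> induces a triangle together with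
  isolated vertices.
\<close>

section \<open>Cycles and forests\<close>

text \<open>The closed walk through \<open>xs\<close> back to its start. For distinct
  \<open>xs\<close> of length at least 3 each edge occurs in one orientation only, so
  edge-disjointness has to exclude the converse arcs too.\<close>

definition cycle_arcs :: "'a list \<Rightarrow> ('a \<times> 'a) list" where
  "cycle_arcs xs = zip xs (rotate1 xs)"

lemma cas_zip: "xs \<noteq> [] \<Longrightarrow> pcas (hd xs) (zip xs (tl xs @ [z])) z"
  by (induction xs rule: induct_list012) auto

lemma undirected_cycle_cycle_arcs:
  assumes "pair_graph G" "distinct xs" "3 \<le> length xs" "set (cycle_arcs xs) \<subseteq> parcs G"
  shows "undirected_cycle G (cycle_arcs xs)"
proof -
  interpret pair_graph G by fact
  have ne: "xs \<noteq> []" using assms(3) by auto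
  have rot: "rotate1 xs = tl xs @ [hd xs]" using ne by (cases xs) auto
  have cas: "pcas (hd xs) (cycle_arcs xs) (hd xs)"
    unfolding cycle_arcs_def rot by (rule cas_zip[OF ne])
  have "cycle_arcs xs \<noteq> []" using ne by (cases xs) (auto simp: cycle_arcs_def)
  moreover have "hd xs \<in> pverts G"
  proof -
    obtain y zs where "rotate1 xs = y # zs" using ne by (metis list.exhaust rotate1_is_Nil_conv)
    then have "(hd xs, y) \<in> set (cycle_arcs xs)" using ne by (cases xs) (auto simp: cycle_arcs_def)
    then show ?thesis using assms(4) by (auto dest: in_arcsD1)
  qed
  moreover have "tl (pawalk_verts (hd xs) (cycle_arcs xs)) = rotate1 xs"
    using awalk_verts_conv'[of "hd xs" "cycle_arcs xs" "hd xs"] cas \<open>cycle_arcs xs \<noteq> []\<close>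
    by (simp add: cycle_arcs_def)
  ultimately show ?thesis
    using assms(2-4) cas
    by (auto simp: undirected_cycle_def cycle_def awalk_def cycle_arcs_def)
qed

lemma set_zip_tl_snoc:
  "zs \<noteq> [] \<Longrightarrow> set (zip zs (tl zs @ [c])) = insert (last zs, c) (set (zip zs (tl zs)))"
  by (induction zs rule: induct_list012) auto

lemma set_zip_tl_append: "set (zip as (tl as)) \<subseteq> set (zip (as @ bs) (tl (as @ bs)))"
  by (induction as rule: induct_list012) auto

text \<open>All neighbours of the first vertex of a longest path lie on that path, and a neighbour
  other than the second vertex closes a cycle of length at least 3.\<close>

lemma exists_cycle_of_min_degree:
  assumes "finite S" "S \<noteq> {}" "A \<subseteq> S \<times> S" "sym A" "irrefl A"
    and deg: "\<And>x. x \<in> S \<Longrightarrow> 2 \<le> card (A `` {x})"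
  shows "\<exists>xs. distinct xs \<and> 3 \<le> length xs \<and> set (cycle_arcs xs) \<subseteq> A"
proof -
  define path where "path xs \<longleftrightarrow> distinct xs \<and> xs \<noteq> [] \<and> set xs \<subseteq> S \<and> set (zip xs (tl xs)) \<subseteq> A" for xs
  obtain s where "s \<in> S" using assms(2) by auto
  then have "path [s]" by (simp add: path_def)
  moreover have "length xs < Suc (card S)" if "path xs" for xs
    using that card_mono[OF assms(1), of "set xs"] by (simp add: path_def distinct_card)
  ultimately obtain xs where xs: "path xs" and max: "\<And>ys. path ys \<Longrightarrow> length ys \<le> length xs"
    using ex_has_greatest_nat[of path "[s]" length "Suc (card S)"] by (metis less_imp_le_nat)
  then obtain x ys where x: "xs = x # ys" by (cases xs) (auto simp: path_def)
  have nbs: "A `` {x} \<subseteq> set ys"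
  proof
    fix y assume y: "y \<in> A `` {x}"
    then have "(y, x) \<in> A" "y \<noteq> x" "y \<in> S"
      using assms(3-5) by (auto dest: symD simp: irrefl_def)
    then show "y \<in> set ys"
      using max[of "y # xs"] xs by (auto simp: path_def x)
  qed
  have "x \<in> S" using xs by (simp add: path_def x)
  have "\<not> A `` {x} \<subseteq> {hd ys}"
    using deg[OF \<open>x \<in> S\<close>] card_mono[of "{hd ys}" "A `` {x}"] by auto
  then obtain y where y: "(x, y) \<in> A" "y \<noteq> hd ys" by auto
  with nbs have "y \<in> set ys" by auto
  then obtain ps qs where ys: "ys = ps @ y # qs" by (meson split_list)
  have ps: "ps \<noteq> []" using y(2) ys by (auto)
  let ?c = "x # ps @ [y]"
  have c: "rotate1 ?c = tl ?c @ [x]" by simp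
  have "set (zip ?c (tl ?c)) \<subseteq> A"
  proof (rule order_trans[OF set_zip_tl_append])
    show "set (zip (?c @ qs) (tl (?c @ qs))) \<subseteq> A"
      using xs by (simp add: path_def x ys)
  qed
  then have "set (cycle_arcs ?c) \<subseteq> A"
    unfolding cycle_arcs_def c set_zip_tl_snoc[of ?c x, simplified list.simps(3)]
    using symD[OF assms(4) y(1)] set_zip_tl_snoc[of ?c x] by simp
  moreover have "distinct ?c" "3 \<le> length ?c"
    using xs ps by (auto simp: path_def x ys Suc_le_eq)
  ultimately show ?thesis by blast
qed

text \<open>\<open>A\<close> holds both orientations of every edge, so \<open>card A\<close> is even
  and the last hypothesis asks for at least as many edges as vertices. This survives deletion of a
  vertex of degree at most 1, which costs at most one edge; once there is none, the minimum degree
  is at least 2.\<close>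

lemma exists_cycle_of_card:
  assumes "finite S" "S \<noteq> {}" "A \<subseteq> S \<times> S" "sym A" "irrefl A" "2 * card S \<le> card A + 1"
  shows "\<exists>xs. distinct xs \<and> 3 \<le> length xs \<and> set (cycle_arcs xs) \<subseteq> A"
  using assms
proof (induction "card S" arbitrary: S A rule: less_induct)
  case less
  show ?case
  proof (cases "\<exists>x\<in>S. card (A `` {x}) < 2")
    case False
    then show ?thesis
      by (intro exists_cycle_of_min_degree[OF less.prems(1-5)]) (auto simp: not_less)
  next
    case True
    then obtain x where x: "x \<in> S" "card (A `` {x}) \<le> 1" by force
    define A' where "A' = A \<inter> (S - {x}) \<times> (S - {x})"
    have finA: "finite A" using less.prems(1,3) by (meson finite_SigmaI finite_subset)
    have "A \<subseteq> A' \<union> Pair x ` (A `` {x}) \<union> (\<lambda>y. (y, x)) ` (A `` {x})"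
      using less.prems(3,4) by (auto simp: A'_def dest: symD)
    then have "card A \<le> card (A' \<union> Pair x ` (A `` {x}) \<union> (\<lambda>y. (y, x)) ` (A `` {x}))"
      using finA by (intro card_mono) (auto simp: A'_def)
    also have "\<dots> \<le> card A' + card (Pair x ` (A `` {x})) + card ((\<lambda>y. (y, x)) ` (A `` {x}))"
      by (meson card_Un_le add_le_mono order_trans order_refl)
    also have "\<dots> \<le> card A' + 1 + 1"
      using x(2) by (simp add: card_image inj_on_def)
    finally have cA: "card A \<le> card A' + 2" by simp
    have cS: "card S = Suc (card (S - {x}))"
      using x(1) less.prems(1) by (metis card.remove)
    \<comment> \<open>A single vertex carries no arc, but the hypothesis asks for at least
      one.\<close>
    have "S - {x} \<noteq> {}"
    proof
      assume "S - {x} = {}"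
      with x(1) have "S = {x}" by auto
      then have "A = {}" using less.prems(3,5) by (auto simp: irrefl_def)
      then show False using less.prems(6) \<open>S = {x}\<close> by simp
    qed
    moreover have "sym A'" "irrefl A'" using less.prems(4,5)
      by (auto simp: A'_def sym_def irrefl_def)
    ultimately have "\<exists>xs. distinct xs \<and> 3 \<le> length xs \<and> set (cycle_arcs xs) \<subseteq> A'"
      using less.prems(1,6) cA cS by (intro less.hyps[of "S - {x}"]) (auto simp: A'_def)
    then show ?thesis by (auto simp: A'_def)
  qed
qed

locale no_edge_disjoint_cycles = pair_graph G for G :: "'a pair_pre_digraph" +
  assumes no_two: "\<not> has_two_edge_disjoint_cycles G"
begin

lemma sym_parcs: "sym (parcs G)"
  using pair_sym_arcs by (simp add: symmetric_def)

lemma not_disjoint_cycles: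
  assumes "distinct xs" "3 \<le> length xs" "set (cycle_arcs xs) \<subseteq> parcs G"
    and "distinct ys" "3 \<le> length ys" "set (cycle_arcs ys) \<subseteq> parcs G"
    and disj: "set (cycle_arcs ys) \<inter> (set (cycle_arcs xs) \<union> (set (cycle_arcs xs))\<inverse>) = {}"
  shows False
proof -
  have "walk_edges (cycle_arcs xs) \<inter> walk_edges (cycle_arcs ys) = {}"
    using disj by (auto simp: walk_edges_def doubleton_eq_iff)
  then show False
    using no_two assms undirected_cycle_cycle_arcs[OF pair_graph]
    unfolding has_two_edge_disjoint_cycles_def by blast
qed

text \<open>Deleting the edges of one cycle leaves a forest, since a cycle in the rest would be
  edge-disjoint from it. So \<open>S\<close> spans at most \<open>card S - 1\<close> edges off the
  cycle; all counts are doubled because arcs are counted.\<close>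

lemma card_induced_arcs_le:
  assumes xs: "distinct xs" "3 \<le> length xs" "set (cycle_arcs xs) \<subseteq> parcs G"
    and S: "finite S" "S \<noteq> {}"
  shows "card (parcs G \<inter> S \<times> S) + 2 \<le> 2 * card S + 2 * length xs"
proof (rule ccontr)
  let ?C = "set (cycle_arcs xs) \<union> (set (cycle_arcs xs))\<inverse>"
  let ?A = "parcs G \<inter> S \<times> S - ?C"
  assume *: "\<not> ?thesis"
  have "card (parcs G \<inter> S \<times> S) \<le> card (?A \<union> ?C)"
    by (rule card_mono) auto
  also have "\<dots> \<le> card ?A + (card (set (cycle_arcs xs)) + card ((set (cycle_arcs xs))\<inverse>))"
    by (meson card_Un_le add_le_mono order_trans order_refl)
  also have "\<dots> \<le> card ?A + 2 * length xs"
    using card_length[of "cycle_arcs xs"] by (simp add: cycle_arcs_def)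
  finally have "2 * card S \<le> card ?A + 1" using * by simp
  moreover have "sym ?A" using sym_parcs by (auto simp: sym_def)
  moreover have "irrefl ?A" using no_loops' by (auto simp: irrefl_def)
  ultimately obtain ys where "distinct ys" "3 \<le> length ys" "set (cycle_arcs ys) \<subseteq> ?A"
    using exists_cycle_of_card[OF S, of ?A] by auto
  then show False
    using not_disjoint_cycles[OF xs, of ys] by blast
qed

end

section \<open>Charging the vertices at distance at least two\<close>

definition deg_in :: "('a \<times> 'a) set \<Rightarrow> 'a set \<Rightarrow> 'a \<Rightarrow> nat" where
  "deg_in E T x = card (E `` {x} \<inter> T)"

text \<open>
  Twice the number of edges that \<open>T\<close> contributes beyond one per vertex, when \<open>c\<close> counts the edges
  to a fixed connected graph outside \<open>T\<close>.
\<close>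

definition excess :: "('a \<times> 'a) set \<Rightarrow> ('a \<Rightarrow> nat) \<Rightarrow> 'a set \<Rightarrow> real" where
  "excess E c T = (\<Sum>x\<in>T. 2 * (real (c x) - 1) + real (deg_in E T x))"

text \<open>The sum of \<open>c x * (c x + deg x)\<close> bounds \<open>k\<close> times the weight of the 2-walks into \<open>T\<close>.\<close>

definition cost :: "('a \<times> 'a) set \<Rightarrow> ('a \<Rightarrow> nat) \<Rightarrow> real \<Rightarrow> 'a set \<Rightarrow> real" where
  "cost E c m T = (\<Sum>x\<in>T. (real (c x))\<^sup>2 - m + real (c x) * real (deg_in E T x))"

lemma deg_in_remove:
  assumes "finite T" "x \<in> T"
  shows "deg_in E T y = deg_in E (T - {x}) y + (if (y, x) \<in> E then 1 else 0)"
proof (cases "(y, x) \<in> E")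
  case True
  then have "E `` {y} \<inter> T = insert x (E `` {y} \<inter> (T - {x}))" using assms by auto
  then show ?thesis using True assms by (simp add: deg_in_def)
next
  case False
  then have "E `` {y} \<inter> T = E `` {y} \<inter> (T - {x})" by auto
  then show ?thesis using False by (simp add: deg_in_def)
qed

text \<open>An edge of \<open>T\<close> between \<open>x\<close> and \<open>y\<close> enters the
  cost twice, with \<open>c x\<close> at \<open>x\<close> and with \<open>c y\<close> at
  \<open>y\<close>. Removing \<open>x\<close> takes away both, together with the own term of
  \<open>x\<close>.\<close>

lemma cost_remove:
  assumes "finite T" "x \<in> T" "sym E" "irrefl E"
  shows "cost E c m T = cost E c m (T - {x}) +
    ((real (c x))\<^sup>2 - m + (\<Sum>y\<in>E `` {x} \<inter> T. real (c x) + real (c y)))"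
proof -
  have "cost E c m T = ((real (c x))\<^sup>2 - m + real (c x) * real (deg_in E T x)) +
      (\<Sum>y\<in>T - {x}. (real (c y))\<^sup>2 - m + real (c y) * real (deg_in E T y))"
    unfolding cost_def by (rule sum.remove[OF assms(1,2)])
  also have "(\<Sum>y\<in>T - {x}. (real (c y))\<^sup>2 - m + real (c y) * real (deg_in E T y)) =
      cost E c m (T - {x}) + (\<Sum>y\<in>T - {x}. if (y, x) \<in> E then real (c y) else 0)"
    unfolding cost_def deg_in_remove[OF assms(1,2), of E] sum.distrib[symmetric]
    by (rule sum.cong) (auto simp: algebra_simps)
  also have "(\<Sum>y\<in>T - {x}. if (y, x) \<in> E then real (c y) else 0) = (\<Sum>y\<in>E `` {x} \<inter> T. real (c y))"
    unfolding sum.inter_filter[symmetric, OF finite_Diff[OF assms(1)]]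
    using assms(3,4) by (intro sum.cong) (auto simp: irrefl_def dest: symD)
  finally show ?thesis by (simp add: sum.distrib deg_in_def)
qed

text \<open>The irreducible sets are those in which every removal of a vertex lowers the cost.\<close>

lemma cost_le_by_removal:
  assumes "finite W" "sym E" "irrefl E"
    and irreducible: "\<And>T. T \<subseteq> W \<Longrightarrow>
      (\<And>x. x \<in> T \<Longrightarrow> 0 < (real (c x))\<^sup>2 - m + (\<Sum>y\<in>E `` {x} \<inter> T. real (c x) + real (c y)))
      \<Longrightarrow> cost E c m T \<le> \<beta>"
  shows "cost E c m W \<le> \<beta>"
proof -
  have "cost E c m T \<le> \<beta>" if "T \<subseteq> W" for T
    using finite_subset[OF that assms(1)] that
  proof (induction T rule: finite_psubset_induct)
    case (psubset T)
    show ?case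
    proof (cases "\<exists>x\<in>T. (real (c x))\<^sup>2 - m + (\<Sum>y\<in>E `` {x} \<inter> T. real (c x) + real (c y)) \<le> 0")
      case True
      then obtain x where x: "x \<in> T"
        "(real (c x))\<^sup>2 - m + (\<Sum>y\<in>E `` {x} \<inter> T. real (c x) + real (c y)) \<le> 0" by blast
      have "cost E c m (T - {x}) \<le> \<beta>"
        using psubset.IH[of "T - {x}"] psubset.prems x(1) by blast
      then show ?thesis
        unfolding cost_remove[OF psubset.hyps x(1) assms(2,3)] using x(2) by simp
    next
      case False
      then show ?thesis using psubset.prems by (intro irreducible) (auto simp: not_le)
    qed
  qed
  then show ?thesis by simp
qed

lemma cost_eq:
  "cost E c m W = (\<Sum>x\<in>W. real (c x) * (real (c x) + real (deg_in E W x))) - m * real (card W)"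
  by (simp add: cost_def sum_subtractf[symmetric] sum.distrib sum_subtractf algebra_simps power2_eq_square)

lemma cost_le_excess:
  assumes "\<And>x. x \<in> T \<Longrightarrow> (real (c x))\<^sup>2 - m + real (c x) * real (deg_in E T x)
      \<le> \<kappa> * (2 * (real (c x) - 1) + real (deg_in E T x))"
  shows "cost E c m T \<le> \<kappa> * excess E c T"
  unfolding cost_def excess_def sum_distrib_left by (rule sum_mono) (rule assms)

lemma sum_nbrs_le_deg_in:
  assumes "\<And>y. y \<in> T \<Longrightarrow> (x, y) \<in> E \<Longrightarrow> f y \<le> b"
  shows "(\<Sum>y\<in>E `` {x} \<inter> T. f y) \<le> real (deg_in E T x) * b"
  unfolding deg_in_def using assms by (intro sum_bounded_above) auto

lemma term_le_excess:
  assumes "finite T" "x \<in> T" "\<And>y. y \<in> T \<Longrightarrow> 0 \<le> 2 * (real (c y) - 1) + real (deg_in E T y)"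
  shows "2 * (real (c x) - 1) + real (deg_in E T x) \<le> excess E c T"
  unfolding excess_def by (rule member_le_sum[OF assms(2) _ assms(1)]) (use assms(3) in auto)

lemma excess_singleton:
  "irrefl E \<Longrightarrow> excess E c {x} = 2 * (real (c x) - 1)"
  by (auto simp: excess_def deg_in_def irrefl_def)

text \<open>Singletons \<open>T\<close> bound \<open>c\<close>. In an irreducible \<open>T\<close>
  no summand of the excess is negative, so each is at most the total, which bounds the degrees; cost
  and excess are then compared vertex by vertex. The next lemma follows the same scheme.\<close>

lemma cost_le_of_excess_le_2:
  assumes W: "finite W" "sym E" "irrefl E"
    and ex: "\<And>T. T \<subseteq> W \<Longrightarrow> excess E c T \<le> \<epsilon>" and "\<epsilon> \<le> 2"
  shows "cost E c 2 W \<le> \<epsilon>"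
proof (rule cost_le_by_removal[OF W])
  fix T assume T: "T \<subseteq> W"
    and irr: "\<And>x. x \<in> T \<Longrightarrow> 0 < (real (c x))\<^sup>2 - 2 + (\<Sum>y\<in>E `` {x} \<inter> T. real (c x) + real (c y))"
  have fin: "finite T" using T W(1) finite_subset by blast
  have c2: "c x \<le> 2" if "x \<in> T" for x
    using ex[of "{x}"] that T excess_singleton[OF W(3), of c x] assms(5) by auto
  have nonneg: "0 \<le> 2 * (real (c x) - 1) + real (deg_in E T x)" if x: "x \<in> T" for x
  proof (cases "c x = 0")
    \<comment> \<open>Irreducibility gives \<open>0 < 2 * deg_in E T x - 2\<close>, hence at least
      two neighbours in \<open>T\<close>.\<close>
    case True
    have "(\<Sum>y\<in>E `` {x} \<inter> T. real (c x) + real (c y)) \<le> real (deg_in E T x) * 2"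
      by (rule sum_nbrs_le_deg_in) (use c2 True in auto)
    then show ?thesis using irr[OF x] True by simp
  qed auto
  have "cost E c 2 T \<le> 1 * excess E c T"
  proof (rule cost_le_excess)
    fix x assume x: "x \<in> T"
    have "2 * (real (c x) - 1) + real (deg_in E T x) \<le> 2"
      using term_le_excess[OF fin x nonneg] ex[OF T] assms(5) by simp
    moreover have "c x = 0 \<or> c x = 1 \<or> c x = 2" using c2[OF x] by auto
    ultimately show "(real (c x))\<^sup>2 - 2 + real (c x) * real (deg_in E T x)
        \<le> 1 * (2 * (real (c x) - 1) + real (deg_in E T x))"
      by auto
  qed
  then show "cost E c 2 T \<le> \<epsilon>" using ex[OF T] by simp
qed

text \<open>The factor \<open>3 / 2\<close> is attained by a vertex with \<open>c x = 3\<close> and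
  no neighbour in \<open>T\<close>, of cost 6 and excess 4.\<close>

lemma cost_le_of_excess_le_4:
  assumes W: "finite W" "sym E" "irrefl E"
    and ex: "\<And>T. T \<subseteq> W \<Longrightarrow> excess E c T \<le> 4"
  shows "cost E c 3 W \<le> 6"
proof (rule cost_le_by_removal[OF W])
  fix T assume T: "T \<subseteq> W"
    and irr: "\<And>x. x \<in> T \<Longrightarrow> 0 < (real (c x))\<^sup>2 - 3 + (\<Sum>y\<in>E `` {x} \<inter> T. real (c x) + real (c y))"
  have fin: "finite T" using T W(1) finite_subset by blast
  have c3: "c x \<le> 3" if "x \<in> T" for x
    using ex[of "{x}"] that T excess_singleton[OF W(3), of c x] by auto
  have nonneg: "0 \<le> 2 * (real (c x) - 1) + real (deg_in E T x)" if x: "x \<in> T" for x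
  proof (cases "c x = 0")
    case True
    have "(\<Sum>y\<in>E `` {x} \<inter> T. real (c x) + real (c y)) \<le> real (deg_in E T x) * 3"
      by (rule sum_nbrs_le_deg_in) (use c3 True in auto)
    then show ?thesis using irr[OF x] True by simp
  qed auto
  have "cost E c 3 T \<le> 3 / 2 * excess E c T"
  proof (rule cost_le_excess)
    fix x assume x: "x \<in> T"
    have "2 * (real (c x) - 1) + real (deg_in E T x) \<le> 4"
      using term_le_excess[OF fin x nonneg] ex[OF T] by simp
    moreover have "c x = 0 \<or> c x = 1 \<or> c x = 2 \<or> c x = 3" using c3[OF x] by auto
    ultimately show "(real (c x))\<^sup>2 - 3 + real (c x) * real (deg_in E T x)
        \<le> 3 / 2 * (2 * (real (c x) - 1) + real (deg_in E T x))"
      by (auto simp: field_simps)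
  qed
  then show "cost E c 3 T \<le> 6" using ex[OF T] by simp
qed

text \<open>The excess alone would allow \<open>c x = 5\<close>, hence the extra hypotheses, which
  the absence of edge-disjoint cycles supplies later. They isolate the vertices with
  \<open>c x = 3\<close> in an irreducible \<open>T\<close>; these attain the factor
  \<open>5 / 4\<close>, with cost 5 and excess 4.\<close>

lemma cost_le_of_excess_le_8:
  assumes W: "finite W" "sym E" "irrefl E"
    and ex: "\<And>T. T \<subseteq> W \<Longrightarrow> excess E c T \<le> 8"
    and c3: "\<And>x. x \<in> W \<Longrightarrow> c x \<le> 3"
    and iso1: "\<And>x y. x \<in> W \<Longrightarrow> y \<in> W \<Longrightarrow> c x = 3 \<Longrightarrow> (x, y) \<in> E \<Longrightarrow> c y = 0"
    and iso2: "\<And>x y z. x \<in> W \<Longrightarrow> y \<in> W \<Longrightarrow> z \<in> W \<Longrightarrow> c x = 3 \<Longrightarrow> (x, y) \<in> E \<Longrightarrow> (y, z) \<in> E \<Longrightarrow>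
      z \<noteq> x \<Longrightarrow> c z = 0"
  shows "cost E c 4 W \<le> 10"
proof (rule cost_le_by_removal[OF W])
  fix T assume T: "T \<subseteq> W"
    and irr: "\<And>x. x \<in> T \<Longrightarrow> 0 < (real (c x))\<^sup>2 - 4 + (\<Sum>y\<in>E `` {x} \<inter> T. real (c x) + real (c y))"
  have fin: "finite T" using T W(1) finite_subset by blast
  have deg3: "deg_in E T x = 0" if x: "x \<in> T" "c x = 3" for x
  proof (rule ccontr)
    assume "deg_in E T x \<noteq> 0"
    then obtain y where y: "y \<in> T" "(x, y) \<in> E" by (auto simp: deg_in_def fin)
    have cy: "c y = 0" using iso1 x y T by blast
    have "c z = 0" if "z \<in> T" "(y, z) \<in> E" "z \<noteq> x" for z
      using iso2[of x y z] x y T that by blast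
    \<comment> \<open>Only \<open>x\<close> among the neighbours of \<open>y\<close> has nonzero
      \<open>c\<close>, so removing \<open>y\<close> changes the cost by \<open>4 - 3 > 0\<close>,
      against irreducibility.\<close>
    then have "(\<Sum>z\<in>E `` {y} \<inter> T. real (c z)) = (\<Sum>z\<in>{x}. real (c z))"
      using x y fin symD[OF W(2) y(2)] by (intro sum.mono_neutral_right) auto
    then show False using irr[OF y(1)] cy x(2) by simp
  qed
  have c_nbr: "c y \<le> 2" if "x \<in> T" "y \<in> T" "(x, y) \<in> E" for x y
  proof -
    have "x \<in> E `` {y} \<inter> T" using symD[OF W(2) that(3)] that by auto
    then have "deg_in E T y \<noteq> 0" using fin by (auto simp: deg_in_def)
    then show ?thesis using deg3[OF that(2)] c3[of y] that T by fastforce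
  qed
  \<comment> \<open>Neighbours have \<open>c\<close> at most 2, so irreducibility demands three
    neighbours if \<open>c x = 0\<close> and two if \<open>c x = 1\<close>.\<close>
  have ge1: "1 \<le> 2 * (real (c x) - 1) + real (deg_in E T x)" if x: "x \<in> T" for x
  proof -
    have "(\<Sum>y\<in>E `` {x} \<inter> T. real (c x) + real (c y)) \<le> real (deg_in E T x) * (real (c x) + 2)"
      by (rule sum_nbrs_le_deg_in) (use c_nbr x in auto)
    moreover have "c x = 0 \<or> c x = 1 \<or> 2 \<le> c x" by auto
    ultimately show ?thesis using irr[OF x] by auto
  qed
  \<comment> \<open>With four neighbours, \<open>x\<close> would account for at least 6 and each
    neighbour for at least 1, more than 8 in total.\<close>
  have deg2: "deg_in E T x \<le> 3" if x: "x \<in> T" "c x = 2" for x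
  proof (rule ccontr)
    assume deg: "\<not> ?thesis"
    let ?t = "\<lambda>y. 2 * (real (c y) - 1) + real (deg_in E T y)"
    let ?N = "E `` {x} \<inter> T"
    have "x \<notin> ?N" using W(3) by (auto simp: irrefl_def)
    have "real (card ?N) \<le> sum ?t ?N"
      using sum_mono[of ?N "\<lambda>_. 1" ?t] ge1 by simp
    moreover have "sum ?t (insert x ?N) \<le> excess E c T"
      unfolding excess_def
    proof (rule sum_mono2[OF fin])
      show "0 \<le> ?t y" if "y \<in> T - insert x ?N" for y
        using ge1[of y] that by simp
    qed (use x in auto)
    moreover have "sum ?t (insert x ?N) = ?t x + sum ?t ?N"
      using fin \<open>x \<notin> ?N\<close> by simp
    ultimately show False using ex[OF T] deg x(2) by (simp add: deg_in_def)
  qed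
  have "cost E c 4 T \<le> 5 / 4 * excess E c T"
  proof (rule cost_le_excess)
    fix x assume x: "x \<in> T"
    have "c x = 0 \<or> c x = 1 \<or> c x = 2 \<or> c x = 3" using c3[of x] x T by auto
    then show "(real (c x))\<^sup>2 - 4 + real (c x) * real (deg_in E T x)
        \<le> 5 / 4 * (2 * (real (c x) - 1) + real (deg_in E T x))"
      using deg2[OF x] deg3[OF x] by (auto simp: field_simps)
  qed
  then show "cost E c 4 T \<le> 10" using ex[OF T] by simp
qed

section \<open>The spectral radius\<close>

text \<open>The Hermitian form of \<open>A\<close> at a complex eigenvector is real by symmetry and
  equals the eigenvalue times the squared norm. So the eigenvalue is real, and the real or the
  imaginary part of the vector is a real eigenvector.\<close>

lemma real_symmetric_eigenvalue_exists:
  fixes A :: "real mat"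
  assumes A: "A \<in> carrier_mat n n" and "0 < n"
    and sym: "\<And>i j. i < n \<Longrightarrow> j < n \<Longrightarrow> A $$ (i, j) = A $$ (j, i)"
  shows "\<exists>k. eigenvalue A k"
proof -
  let ?C = "map_mat complex_of_real A"
  have C: "?C \<in> carrier_mat n n" using A by simp
  obtain z where "eigenvalue ?C z"
    using spectrum_non_empty[OF C \<open>0 < n\<close>] by (auto simp: spectrum_def)
  then obtain v where v: "v \<in> carrier_vec n" "v \<noteq> 0\<^sub>v n" "?C *\<^sub>v v = z \<cdot>\<^sub>v v"
    using A by (auto simp: eigenvalue_def eigenvector_def)
  have eq: "(\<Sum>j<n. of_real (A $$ (i, j)) * v $ j) = z * v $ i" if "i < n" for i
  proof -
    have "(?C *\<^sub>v v) $ i = (\<Sum>j<n. of_real (A $$ (i, j)) * v $ j)"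
      using A v(1) that by (simp add: scalar_prod_def lessThan_atLeast0)
    then show ?thesis using v(1,3) that by simp
  qed
  let ?Q = "\<Sum>i<n. \<Sum>j<n. of_real (A $$ (i, j)) * v $ j * cnj (v $ i)"
  have "?Q = (\<Sum>i<n. z * v $ i * cnj (v $ i))"
    by (simp add: eq[symmetric] sum_distrib_right)
  also have "\<dots> = z * of_real (\<Sum>i<n. (cmod (v $ i))\<^sup>2)"
    by (simp only: sum_distrib_left of_real_sum mult.assoc complex_norm_square)
  finally have Q: "?Q = z * of_real (\<Sum>i<n. (cmod (v $ i))\<^sup>2)" .
  have "cnj ?Q = (\<Sum>i<n. \<Sum>j<n. of_real (A $$ (i, j)) * cnj (v $ j) * v $ i)"
    by simp
  also have "\<dots> = (\<Sum>j<n. \<Sum>i<n. of_real (A $$ (i, j)) * cnj (v $ j) * v $ i)"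
    by (rule sum.swap)
  also have "\<dots> = ?Q"
    by (intro sum.cong refl) (simp add: sym mult_ac)
  finally have "?Q \<in> \<real>" by (simp only: Reals_cnj_iff)
  then have "Im ?Q = 0" by (simp only: complex_is_Real_iff)
  obtain i0 where i0: "i0 < n" "v $ i0 \<noteq> 0"
    using v(1,2) by (metis carrier_vecD eq_vecI index_zero_vec)
  have "0 < (\<Sum>i<n. (cmod (v $ i))\<^sup>2)"
    by (rule sum_pos2[of _ i0]) (use i0 in auto)
  then have z: "z = of_real (Re z)"
    using \<open>Im ?Q = 0\<close> unfolding Q by (simp add: complex_eq_iff)
  have real_part: "eigenvalue A (Re z)"
    if h: "h = Re \<or> h = Im" and "h (v $ i0) \<noteq> 0" for h
  proof -
    let ?w = "vec n (\<lambda>i. h (v $ i))"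
    have "h (\<Sum>j<n. of_real (A $$ (i, j)) * v $ j) = (\<Sum>j<n. A $$ (i, j) * h (v $ j))" for i
      using h by (auto simp: Re_sum Im_sum)
    moreover have "h (z * v $ i) = Re z * h (v $ i)" for i
      using h by (subst z) auto
    ultimately have "(\<Sum>j<n. A $$ (i, j) * h (v $ j)) = Re z * h (v $ i)" if "i < n" for i
      using eq[OF that] by metis
    then have "A *\<^sub>v ?w = Re z \<cdot>\<^sub>v ?w"
      using A by (intro eq_vecI) (auto simp: scalar_prod_def lessThan_atLeast0)
    moreover have "?w \<noteq> 0\<^sub>v n"
      using that i0 by (metis index_vec index_zero_vec(1))
    ultimately show ?thesis
      using A by (auto simp: eigenvalue_def eigenvector_def intro!: exI[of _ ?w])
  qed
  have "Re (v $ i0) \<noteq> 0 \<or> Im (v $ i0) \<noteq> 0" using i0(2) by (simp add: complex_eq_iff)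
  then show ?thesis using real_part by blast
qed

context pair_graph
begin

text \<open>Makes the \<open>Max\<close> in \<open>graph_spectral_radius_def\<close> meaningful:
  eigenvalues are roots of the characteristic polynomial, and symmetry provides a real one.\<close>

lemma adjacency_matrix_eigenvalues:
  assumes "distinct vs" "set vs = pverts G" "pverts G \<noteq> {}"
  shows "finite {k. eigenvalue (adjacency_matrix G vs) k}" "{k. eigenvalue (adjacency_matrix G vs) k} \<noteq> {}"
proof -
  let ?n = "length vs"
  have A: "adjacency_matrix G vs \<in> carrier_mat ?n ?n"
    by (simp add: adjacency_matrix_def)
  have "char_poly (adjacency_matrix G vs) \<noteq> 0"
    using degree_monic_char_poly[OF A] by auto
  then show "finite {k. eigenvalue (adjacency_matrix G vs) k}"
    unfolding eigenvalue_root_char_poly[OF A] by (rule poly_roots_finite)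
  have "0 < ?n" using assms(2,3) by auto
  moreover have "adjacency_matrix G vs $$ (i, j) = adjacency_matrix G vs $$ (j, i)"
    if "i < ?n" "j < ?n" for i j
    using that arcs_symmetric by (auto simp: adjacency_matrix_def)
  ultimately show "{k. eigenvalue (adjacency_matrix G vs) k} \<noteq> {}"
    using real_symmetric_eigenvalue_exists[OF A] by blast
qed

lemma graph_spectral_radius_eigenfunction:
  assumes "pverts G \<noteq> {}"
  obtains f where "\<exists>v\<in>pverts G. f v \<noteq> 0"
    "\<And>v. v \<in> pverts G \<Longrightarrow> (\<Sum>u\<in>parcs G `` {v}. f u) = graph_spectral_radius G * f v"
proof -
  note vs = vertex_enum[OF pair_finite_verts]
  have "eigenvalue (adjacency_matrix G (vertex_enum G)) (graph_spectral_radius G)"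
    using Max_in[OF adjacency_matrix_eigenvalues[OF vs assms]]
    by (simp add: graph_spectral_radius_def)
  moreover have "{u \<in> pverts G. (v, u) \<in> parcs G} = parcs G `` {v}" for v
    by (auto dest: in_arcsD2)
  ultimately show ?thesis
    using that unfolding eigenvalue_adjacency_matrix_iff[OF vs] by auto
qed

lemma graph_spectral_radius_ge:
  assumes "v \<in> pverts G" "f v \<noteq> 0"
    and "\<And>v. v \<in> pverts G \<Longrightarrow> (\<Sum>u\<in>parcs G `` {v}. f u) = k * f v"
  shows "k \<le> graph_spectral_radius G"
proof -
  note vs = vertex_enum[OF pair_finite_verts]
  have "{u \<in> pverts G. (v, u) \<in> parcs G} = parcs G `` {v}" for v
    by (auto dest: in_arcsD2)
  then have "eigenvalue (adjacency_matrix G (vertex_enum G)) k"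
    unfolding eigenvalue_adjacency_matrix_iff[OF vs] using assms by auto
  moreover have "pverts G \<noteq> {}" using assms(1) by auto
  ultimately show ?thesis
    unfolding graph_spectral_radius_def
    by (intro Max_ge adjacency_matrix_eigenvalues[OF vs]) auto
qed

end

section \<open>The spectral radius of the extremal graph\<close>

lemma pverts_K4_bullet_star:
  "pverts (K4_bullet_star n) = Inl ` {0, 1, 2, 3} \<union> (\<lambda>j. Inr (Inr j)) ` {..<n - 4}"
proof -
  have "{..<4::nat} = {0, 1, 2, 3}" by auto
  then show ?thesis
    by (auto simp: K4_bullet_star_def coalescence_def complete_graph_def
        complete_bipartite_graph_def Let_def image_iff split: if_splits)
qed

lemma parcs_K4_bullet_star:
  "parcs (K4_bullet_star n) = {(Inl i, Inl j) | i j. i \<in> {0, 1, 2, 3} \<and> j \<in> {0, 1, 2, 3} \<and> i \<noteq> j} \<union>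
    {(Inl 0, Inr (Inr j)) | j. j < n - 4} \<union> {(Inr (Inr j), Inl 0) | j. j < n - 4}"
proof -
  have K: "parcs (complete_graph 4) = {(i, j) | i j. i \<in> {0, 1, 2, 3} \<and> j \<in> {0, 1, 2, 3} \<and> i \<noteq> j}"
    by (auto simp: complete_graph_def)
  have F: "parcs (complete_bipartite_graph 1 (n - 4)) =
      (\<lambda>j. (Inl 0, Inr j)) ` {..<n - 4} \<union> (\<lambda>j. (Inr j, Inl 0)) ` {..<n - 4}"
    by (auto simp: complete_bipartite_graph_def)
  let ?\<iota> = "\<lambda>x. if x = Inl 0 then Inl 0 else Inr x"
  have K': "map_prod Inl Inl ` parcs (complete_graph 4) =
      {(Inl i, Inl j) | i j. i \<in> {0, 1, 2, 3} \<and> j \<in> {0, 1, 2, 3} \<and> i \<noteq> j}"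
    unfolding K by (auto simp del: insert_iff)
  have F': "map_prod ?\<iota> ?\<iota> ` parcs (complete_bipartite_graph 1 (n - 4)) =
      {(Inl 0, Inr (Inr j)) | j. j < n - 4} \<union> {(Inr (Inr j), Inl 0) | j. j < n - 4}"
    unfolding F by (simp add: image_Un image_image) auto
  show ?thesis
    unfolding K4_bullet_star_def coalescence_def Let_def
    by (simp only: K' F' Un_assoc pair_pre_digraph.simps)
qed

text \<open>With value 1 at the centre, the eigenvalue equation forces \<open>1 / (r - 2)\<close> on
  the rest of the complete graph and \<open>1 / r\<close> on the pendant vertices. At the centre it
  then becomes the cubic in the hypothesis.\<close>

lemma spectral_radius_K4_bullet_star_ge:
  assumes "4 \<le> n" "2 < r" "(r - 2) * (r\<^sup>2 - (real n - 1)) = 6"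
  shows "r \<le> graph_spectral_radius (K4_bullet_star n)"
proof -
  define f :: "nat + (nat + nat) \<Rightarrow> real" where
    "f x = (case x of Inl i \<Rightarrow> if i = 0 then 1 else 1 / (r - 2) | Inr _ \<Rightarrow> 1 / r)" for x
  let ?nb = "\<lambda>v. parcs (K4_bullet_star n) `` {v}"
  have nb0: "?nb (Inl 0) = Inl ` {1, 2, 3} \<union> (\<lambda>j. Inr (Inr j)) ` {..<n - 4}"
    and nb1: "?nb (Inl 1) = Inl ` {0, 2, 3}" and nb2: "?nb (Inl 2) = Inl ` {0, 1, 3}"
    and nb3: "?nb (Inl 3) = Inl ` {0, 1, 2}"
    and nbr: "\<And>j. j < n - 4 \<Longrightarrow> ?nb (Inr (Inr j)) = {Inl 0}"
    unfolding parcs_K4_bullet_star by auto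
  have "sum f (?nb (Inl 0)) = sum f (Inl ` {1, 2, 3}) + sum f ((\<lambda>j. Inr (Inr j)) ` {..<n - 4})"
    unfolding nb0 by (rule sum.union_disjoint) auto
  also have "sum f ((\<lambda>j. Inr (Inr j)) ` {..<n - 4}) = real (n - 4) / r"
    by (subst sum.reindex) (auto simp: inj_on_def f_def)
  also have "sum f (Inl ` {1, 2, 3}) = 3 / (r - 2)"
    by (simp add: f_def)
  \<comment> \<open>Multiply by \<open>r\<close> and use
    \<open>3 * r / (r - 2) = 3 + 6 / (r - 2)\<close>.\<close>
  also have "3 / (r - 2) + real (n - 4) / r = r"
    using assms by (simp add: field_simps of_nat_diff power2_eq_square power3_eq_cube)
  finally have s0: "sum f (?nb (Inl 0)) = r" .
  have "sum f (?nb v) = r * f v" if v: "v \<in> pverts (K4_bullet_star n)" for v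
  proof -
    consider "v = Inl 0" | "v = Inl 1" | "v = Inl 2" | "v = Inl 3" | j where "j < n - 4" "v = Inr (Inr j)"
      using v unfolding pverts_K4_bullet_star by auto
    then show ?thesis
    proof cases
      case 1
      then show ?thesis using s0 by (simp add: f_def)
    next
      case 2
      then show ?thesis using nb1 assms(2) by (simp add: f_def field_simps)
    next
      case 3
      then show ?thesis using nb2 assms(2) by (simp add: f_def field_simps)
    next
      case 4
      then show ?thesis using nb3 assms(2) by (simp add: f_def field_simps)
    next
      case 5
      then show ?thesis using nbr assms(2) by (simp add: f_def)
    qed
  qed
  then show ?thesis
    by (intro pair_graph.graph_spectral_radius_ge[OF pair_graph_K4_bullet_star, of "Inl 0" _ f])
      (auto simp: pverts_K4_bullet_star f_def)
qed

lemma spectral_radius_K4_bullet_star_lower: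
  assumes "17 \<le> n" "graph_spectral_radius (K4_bullet_star n) \<le> k"
  shows "4 < k" "6 \<le> (k - 2) * (k\<^sup>2 - (real n - 1))"
proof -
  let ?f = "\<lambda>x::real. (x - 2) * (x\<^sup>2 - (real n - 1))"
  have "\<exists>r\<ge>4. r \<le> real n \<and> ?f r = 6"
  proof (rule IVT')
    \<comment> \<open>Here \<open>?f 4 = 2 * (17 - n)\<close>, so \<open>17 \<le> n\<close> puts the
      root above 4.\<close>
    show "?f 4 \<le> 6" using assms(1) by simp
    have "15 * 1 \<le> (real n - 2) * ((real n)\<^sup>2 - (real n - 1))"
    proof (rule mult_mono)
      have "17 * real n \<le> real n * real n" using assms(1) by (intro mult_right_mono) auto
      then show "1 \<le> (real n)\<^sup>2 - (real n - 1)" unfolding power2_eq_square using assms(1) by linarith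
    qed (use assms(1) in auto)
    then show "6 \<le> ?f (real n)" by simp
    show "4 \<le> real n" using assms(1) by simp
    show "continuous_on {4..real n} ?f" by (intro continuous_intros)
  qed
  then obtain r where r: "4 \<le> r" "?f r = 6" by blast
  have "r \<noteq> 4" using r(2) assms(1) by auto
  have rk: "r \<le> k"
    using spectral_radius_K4_bullet_star_ge[of n r] r assms by simp
  show "4 < k" using r(1) \<open>r \<noteq> 4\<close> rk by simp
  \<comment> \<open>Both factors of \<open>?f r\<close> are nonnegative and grow with the argument,
    so \<open>?f r \<le> ?f k\<close>.\<close>
  have "0 < ?f r" using r(2) by simp
  then have "0 \<le> r\<^sup>2 - (real n - 1)"
    using r(1) by (auto simp: zero_less_mult_iff)
  moreover have "r\<^sup>2 \<le> k\<^sup>2" using rk r(1) by (intro power_mono) auto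
  ultimately have "?f r \<le> ?f k" using rk r(1) by (intro mult_mono) auto
  then show "6 \<le> ?f k" using r(2) by simp
qed

section \<open>The neighbourhood of a vertex\<close>

lemma sum_nbrs_eq:
  "finite T \<Longrightarrow> (\<Sum>y\<in>E `` {x} \<inter> T. g y) = (\<Sum>y\<in>T. if (x, y) \<in> E then g y else 0)"
  using sum.inter_restrict[of T g "E `` {x}"] by (simp add: Int_commute)

lemma deg_in_eq_sum: "finite T \<Longrightarrow> deg_in E T x = (\<Sum>y\<in>T. if (x, y) \<in> E then 1 else 0)"
  using sum_nbrs_eq[of T "\<lambda>_. 1 :: nat" E x] by (simp add: deg_in_def)

lemma deg_in_Un:
  "finite S \<Longrightarrow> finite T \<Longrightarrow> S \<inter> T = {} \<Longrightarrow> deg_in E (S \<union> T) x = deg_in E S x + deg_in E T x"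
  by (simp add: deg_in_eq_sum sum.union_disjoint)

lemma card_Restr_eq_sum_deg_in: "finite X \<Longrightarrow> card (E \<inter> X \<times> X) = (\<Sum>x\<in>X. deg_in E X x)"
proof -
  assume "finite X"
  moreover have "E \<inter> X \<times> X = Sigma X (\<lambda>x. E `` {x} \<inter> X)" by auto
  ultimately show ?thesis by (simp add: deg_in_def)
qed

text \<open>Double counting of the edges between \<open>S\<close> and \<open>T\<close>; it regroups
  walks by their last vertex instead of their middle one.\<close>

lemma sum_nbrs_swap:
  fixes f g :: "'a \<Rightarrow> real"
  assumes "sym E" "finite S" "finite T"
  shows "(\<Sum>v\<in>S. f v * (\<Sum>y\<in>E `` {v} \<inter> T. g y)) = (\<Sum>y\<in>T. (\<Sum>v\<in>E `` {y} \<inter> S. f v) * g y)"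
proof -
  have "(\<Sum>v\<in>S. f v * (\<Sum>y\<in>E `` {v} \<inter> T. g y)) =
      (\<Sum>v\<in>S. \<Sum>y\<in>T. if (v, y) \<in> E then f v * g y else 0)"
    unfolding sum_nbrs_eq[OF assms(3)] sum_distrib_left by (intro sum.cong refl) auto
  also have "\<dots> = (\<Sum>y\<in>T. \<Sum>v\<in>S. if (v, y) \<in> E then f v * g y else 0)"
    by (rule sum.swap)
  also have "\<dots> = (\<Sum>y\<in>T. \<Sum>v\<in>S. if (y, v) \<in> E then f v * g y else 0)"
    using assms(1) by (intro sum.cong refl if_cong) (auto dest: symD)
  also have "\<dots> = (\<Sum>y\<in>T. (\<Sum>v\<in>E `` {y} \<inter> S. f v) * g y)"
    unfolding sum_nbrs_eq[OF assms(2)] sum_distrib_right by (intro sum.cong refl) auto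
  finally show ?thesis .
qed

lemma sum_deg_in_swap:
  assumes "sym E" "finite S" "finite T"
  shows "(\<Sum>v\<in>S. deg_in E T v) = (\<Sum>w\<in>T. deg_in E S w)"
proof -
  have "real (\<Sum>v\<in>S. deg_in E T v) = real (\<Sum>w\<in>T. deg_in E S w)"
    using sum_nbrs_swap[OF assms, of "\<lambda>_. 1" "\<lambda>_. 1"] by (simp add: deg_in_def)
  then show ?thesis by (simp only: of_nat_eq_iff)
qed

section \<open>Local structure around a vertex \<open>u\<close>\<close>

locale rooted_no_edge_disjoint_cycles = no_edge_disjoint_cycles G
  for G :: "'a pair_pre_digraph" +
  fixes u :: 'a
  assumes u: "u \<in> pverts G"
begin

abbreviation E :: "('a \<times> 'a) set" where "E \<equiv> parcs G"
definition N :: "'a set" where "N = E `` {u}"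
definition W :: "'a set" where "W = pverts G - insert u N"
definition c :: "'a \<Rightarrow> nat" where "c = deg_in E N"
text \<open>Twice the number of edges inside \<open>N\<close>.\<close>

definition nbr_arcs :: nat where "nbr_arcs = (\<Sum>v\<in>N. deg_in E N v)"

lemma irrefl_E: "irrefl E"
  using no_loops' by (auto simp: irrefl_def)

lemma N_subset: "N \<subseteq> pverts G - {u}"
  using no_loops' by (auto simp: N_def dest: in_arcsD2)

lemma finite_N: "finite N" and finite_W: "finite W"
proof -
  show "finite N" by (rule finite_subset[OF N_subset]) simp
  show "finite W" by (simp add: W_def)
qed

lemma card_pverts: "card (pverts G) = Suc (card N + card W)"
proof -
  have "pverts G = insert u (N \<union> W)" using N_subset u by (auto simp: W_def)
  moreover have "u \<notin> N \<union> W" "N \<inter> W = {}" using N_subset by (auto simp: W_def)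
  ultimately show ?thesis by (simp add: card_Un_disjoint finite_N finite_W)
qed

lemma not_adj_u: "w \<in> W \<Longrightarrow> (w, u) \<notin> E"
  using arcs_symmetric[of w u] by (auto simp: W_def N_def)

lemma adj_u: "v \<in> N \<Longrightarrow> (u, v) \<in> E" "v \<in> N \<Longrightarrow> (v, u) \<in> E"
  using arcs_symmetric[of u v] by (auto simp: N_def)

lemma obtain_c_nbrs:
  assumes "m \<le> c w"
  obtains B where "B \<subseteq> N" "card B = m" "\<And>b. b \<in> B \<Longrightarrow> (w, b) \<in> E"
proof -
  obtain B where "B \<subseteq> E `` {w} \<inter> N" "card B = m"
    using obtain_subset_with_card_n[OF assms[unfolded c_def deg_in_def]] by blast
  then show ?thesis using that by auto
qed

text \<open>
  Counts the edges of the subgraph induced by \<open>{u} \<union> N \<union> S\<close>, which is a forest up to the edges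
  of the cycle.
\<close>

lemma nbr_arcs_plus_excess_le:
  assumes xs: "distinct xs" "3 \<le> length xs" "set (cycle_arcs xs) \<subseteq> E" and S: "S \<subseteq> W"
  shows "real nbr_arcs + excess E c S \<le> 2 * real (length xs)"
proof -
  let ?X = "insert u (N \<union> S)"
  have fin: "finite S" using S finite_W finite_subset by blast
  have disj: "u \<notin> N \<union> S" "N \<inter> S = {}" using N_subset S by (auto simp: W_def)
  have ins: "deg_in E ?X x = deg_in E {u} x + (deg_in E N x + deg_in E S x)" for x
    using deg_in_Un[of "{u}" "N \<union> S" E x] deg_in_Un[of N S E x] disj fin finite_N by simp
  have "E `` {u} \<inter> ?X = N" using irrefl_E by (auto simp: N_def irrefl_def)
  then have du: "deg_in E ?X u = card N" by (simp add: deg_in_def)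
  have dN: "deg_in E {u} v = 1" if "v \<in> N" for v
  proof -
    have "E `` {v} \<inter> {u} = {u}" using adj_u[OF that] by auto
    then show ?thesis by (simp add: deg_in_def)
  qed
  have dS: "deg_in E {u} w = 0" if "w \<in> S" for w
    using not_adj_u that S by (auto simp: deg_in_def)
  have "card (E \<inter> ?X \<times> ?X) = deg_in E ?X u + (\<Sum>x\<in>N. deg_in E ?X x) + (\<Sum>x\<in>S. deg_in E ?X x)"
    unfolding card_Restr_eq_sum_deg_in[OF finite.insertI[OF finite_UnI[OF finite_N fin]]]
    using disj fin finite_N by (simp add: sum.union_disjoint)
  also have "(\<Sum>x\<in>N. deg_in E ?X x) = card N + nbr_arcs + (\<Sum>w\<in>S. c w)"
    unfolding ins sum.distrib
    using dN sum_deg_in_swap[OF sym_parcs finite_N fin] by (simp add: nbr_arcs_def c_def)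
  also have "(\<Sum>x\<in>S. deg_in E ?X x) = (\<Sum>w\<in>S. c w) + (\<Sum>w\<in>S. deg_in E S w)"
    unfolding ins sum.distrib using dS by (simp add: c_def)
  finally have "card (E \<inter> ?X \<times> ?X) = 2 * card N + nbr_arcs + 2 * (\<Sum>w\<in>S. c w) + (\<Sum>w\<in>S. deg_in E S w)"
    using du by simp
  moreover have "card ?X = Suc (card N + card S)"
    using disj fin finite_N by (simp add: card_Un_disjoint)
  moreover have "card (E \<inter> ?X \<times> ?X) + 2 \<le> 2 * card ?X + 2 * length xs"
    using card_induced_arcs_le[OF xs, of ?X] fin finite_N by simp
  ultimately have "nbr_arcs + 2 * (\<Sum>w\<in>S. c w) + (\<Sum>w\<in>S. deg_in E S w) \<le> 2 * card S + 2 * length xs"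
    by simp
  then have "real (nbr_arcs + 2 * (\<Sum>w\<in>S. c w) + (\<Sum>w\<in>S. deg_in E S w)) \<le> real (2 * card S + 2 * length xs)"
    by (simp only: of_nat_le_iff)
  then show ?thesis
    by (simp add: excess_def sum.distrib sum_subtractf sum_distrib_left[symmetric])
qed

text \<open>Three neighbours \<open>a\<close>, \<open>b\<close>, \<open>d\<close> of
  \<open>v\<close> in \<open>N\<close> would give the triangle \<open>u, a, v\<close> and the
  4-cycle \<open>u, b, v, d\<close>, which share no edge.\<close>

lemma deg_N_le_2:
  assumes "v \<in> N"
  shows "deg_in E N v \<le> 2"
proof (rule ccontr)
  assume "\<not> ?thesis"
  then have "3 \<le> card (E `` {v} \<inter> N)" by (simp add: deg_in_def)
  then obtain B where B: "B \<subseteq> E `` {v} \<inter> N" "card B = 3"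
    by (rule obtain_subset_with_card_n)
  from B(2) obtain a b d where eq: "B = {a, b, d}" "a \<noteq> b" "a \<noteq> d" "b \<noteq> d"
    by (auto simp: card_3_iff)
  with B(1) have abd: "a \<in> N" "b \<in> N" "d \<in> N" "(v, a) \<in> E" "(v, b) \<in> E" "(v, d) \<in> E"
    "a \<noteq> b" "a \<noteq> d" "b \<noteq> d" by simp_all
  note sy = abd(4-6)[THEN arcs_symmetric]
  have "u \<noteq> v" "u \<noteq> a" "u \<noteq> b" "u \<noteq> d"
    using abd(1-3) assms N_subset by auto
  moreover have "v \<noteq> a" "v \<noteq> b" "v \<noteq> d"
    using abd(4-6)[THEN no_loops'] by simp_all
  ultimately
  show False
    using not_disjoint_cycles[of "[u, a, v]" "[u, b, v, d]"] abd sy adj_u assms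
    by (auto simp: cycle_arcs_def)
qed

text \<open>Two disjoint edges inside \<open>N\<close> would form with \<open>u\<close> two
  triangles that share only \<open>u\<close>.\<close>

lemma N_edges_intersect:
  assumes "a \<in> N" "b \<in> N" "x \<in> N" "y \<in> N" "(a, b) \<in> E" "(x, y) \<in> E"
  shows "{a, b} \<inter> {x, y} \<noteq> {}"
proof
  assume "{a, b} \<inter> {x, y} = {}"
  moreover have "u \<noteq> a" "u \<noteq> b" "u \<noteq> x" "u \<noteq> y"
    using assms(1-4) N_subset by auto
  moreover have "a \<noteq> b" "x \<noteq> y"
    using assms(5,6)[THEN no_loops'] by simp_all
  ultimately show False
    using not_disjoint_cycles[of "[u, a, b]" "[u, x, y]"] assms adj_u
    by (auto simp: cycle_arcs_def)
qed

text \<open>Four neighbours in \<open>N\<close> would pair up into two edge-disjoint 4-cycles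
  through \<open>u\<close> and \<open>w\<close>.\<close>

lemma c_le_3:
  assumes "w \<in> W"
  shows "c w \<le> 3"
proof (rule ccontr)
  assume "\<not> ?thesis"
  then obtain B where B: "B \<subseteq> N" "card B = 4" "\<And>b. b \<in> B \<Longrightarrow> (w, b) \<in> E"
    using obtain_c_nbrs[of 4 w] by auto
  have "finite B" using B(2) card.infinite by fastforce
  obtain a where a: "a \<in> B" using B(2) by fastforce
  then have "card (B - {a}) = 3" using B(2) \<open>finite B\<close> by simp
  then obtain b d e where bde: "B - {a} = {b, d, e}" "b \<noteq> d" "b \<noteq> e" "d \<noteq> e"
    by (auto simp: card_3_iff)
  have mem: "b \<in> B" "d \<in> B" "e \<in> B" "a \<noteq> b" "a \<noteq> d" "a \<noteq> e" using bde by auto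
  note E = B(3)[OF a] mem(1-3)[THEN B(3)]
  note sy = E[THEN arcs_symmetric]
  have "u \<noteq> w" "u \<notin> B" "w \<notin> B" using assms B(1) N_subset by (auto simp: W_def)
  then show False
    using not_disjoint_cycles[of "[u, a, w, b]" "[u, d, w, e]"] a mem bde(2-) E sy adj_u B(1)
    by (auto simp: cycle_arcs_def subset_iff)
qed

text \<open>
  If \<open>c w = 3\<close>, a path from \<open>w\<close> through \<open>W\<close> to a vertex \<open>v\<close> of \<open>N\<close> closes to a cycle
  avoiding a 4-cycle through \<open>u\<close>, \<open>w\<close> and two neighbours of \<open>w\<close> other than \<open>v\<close>.
\<close>

lemma obtain_nbrs_of_c_eq_3:
  assumes "c w = 3"
  obtains a b d where "a \<in> N" "b \<in> N" "d \<in> N" "(w, a) \<in> E" "(w, b) \<in> E" "(w, d) \<in> E"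
    "(a, w) \<in> E" "(b, w) \<in> E" "(d, w) \<in> E"
    "a \<noteq> b" "a \<noteq> d" "b \<noteq> d" "v \<noteq> a" "v \<noteq> b"
proof -
  obtain B where B: "B \<subseteq> N" "card B = 3" "\<And>b. b \<in> B \<Longrightarrow> (w, b) \<in> E"
    using obtain_c_nbrs[of 3 w] assms by auto
  then obtain x y z where xyz: "B = {x, y, z}" "x \<noteq> y" "x \<noteq> z" "y \<noteq> z"
    by (auto simp: card_3_iff)
  have mem: "x \<in> N" "y \<in> N" "z \<in> N" using B(1) xyz by auto
  have E: "(w, x) \<in> E" "(w, y) \<in> E" "(w, z) \<in> E" using B(3) xyz by auto
  note sy = E[THEN arcs_symmetric]
  \<comment> \<open>If \<open>v\<close> is one of the three neighbours, it takes the name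
    \<open>d\<close>.\<close>
  consider "v \<noteq> x" "v \<noteq> y" | "v = x" | "v = y" by auto
  then show ?thesis
  proof cases
    case 1
    then show ?thesis using that[of x y z] mem E sy xyz by blast
  next
    case 2
    then show ?thesis using that[of y z x] mem E sy xyz by blast
  next
    case 3
    then show ?thesis using that[of x z y] mem E sy xyz by blast
  qed
qed

lemma c_eq_0_if_adj_c_eq_3:
  assumes "w \<in> W" "y \<in> W" "c w = 3" "(w, y) \<in> E"
  shows "c y = 0"
proof (rule ccontr)
  assume "c y \<noteq> 0"
  then obtain v where v: "v \<in> N" "(y, v) \<in> E"
    using finite_N by (auto simp: c_def deg_in_def)
  from obtain_nbrs_of_c_eq_3[OF assms(3), of v]
  obtain a b d where abd: "a \<in> N" "b \<in> N" "d \<in> N" "(w, a) \<in> E" "(w, b) \<in> E" "(w, d) \<in> E"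
    "(a, w) \<in> E" "(b, w) \<in> E" "(d, w) \<in> E"
    "a \<noteq> b" "a \<noteq> d" "b \<noteq> d" "v \<noteq> a" "v \<noteq> b" by blast
  have ne: "u \<noteq> w" "u \<noteq> y" "w \<noteq> y" "u \<notin> N" "w \<notin> N" "y \<notin> N"
    using assms assms(4)[THEN no_loops'] N_subset by (auto simp: W_def)
  then have ne': "a \<noteq> u" "b \<noteq> u" "d \<noteq> u" "v \<noteq> u" "a \<noteq> w" "b \<noteq> w" "d \<noteq> w" "v \<noteq> w"
    "a \<noteq> y" "b \<noteq> y" "d \<noteq> y" "v \<noteq> y"
    using abd(1-3) v(1) by auto
  note sy = v(2)[THEN arcs_symmetric] assms(4)[THEN arcs_symmetric]
  show False
  \<comment> \<open>The path \<open>w, y, v\<close> closes along the edge from \<open>d\<close> to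
    \<open>w\<close> if \<open>v = d\<close>, and through \<open>u\<close> and \<open>d\<close>
    otherwise; both ways avoid the 4-cycle \<open>u, a, w, b\<close>.\<close>
  proof (cases "v = d")
    case True
    then show False
      using not_disjoint_cycles[of "[u, a, w, b]" "[w, y, v]"] abd v assms(4) adj_u ne ne' sy
      by (auto simp: cycle_arcs_def)
  next
    case False
    then show False
      using not_disjoint_cycles[of "[u, a, w, b]" "[w, y, v, u, d]"] abd v assms(4) adj_u ne ne' sy
      by (auto simp: cycle_arcs_def)
  qed
qed

text \<open>The same two closing cycles, along a path with one more vertex;
  \<open>z \<noteq> w\<close> keeps it a path.\<close>

lemma c_eq_0_if_dist_2_c_eq_3:
  assumes "w \<in> W" "y \<in> W" "z \<in> W" "c w = 3" "(w, y) \<in> E" "(y, z) \<in> E" "z \<noteq> w"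
  shows "c z = 0"
proof (rule ccontr)
  assume "c z \<noteq> 0"
  then obtain v where v: "v \<in> N" "(z, v) \<in> E"
    using finite_N by (auto simp: c_def deg_in_def)
  from obtain_nbrs_of_c_eq_3[OF assms(4), of v]
  obtain a b d where abd: "a \<in> N" "b \<in> N" "d \<in> N" "(w, a) \<in> E" "(w, b) \<in> E" "(w, d) \<in> E"
    "(a, w) \<in> E" "(b, w) \<in> E" "(d, w) \<in> E"
    "a \<noteq> b" "a \<noteq> d" "b \<noteq> d" "v \<noteq> a" "v \<noteq> b" by blast
  have ne: "u \<noteq> w" "u \<noteq> y" "u \<noteq> z" "w \<noteq> y" "y \<noteq> z" "z \<noteq> w" "u \<notin> N" "w \<notin> N" "y \<notin> N" "z \<notin> N"
    using assms assms(5,6)[THEN no_loops'] N_subset by (auto simp: W_def)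
  then have ne': "a \<noteq> u" "b \<noteq> u" "d \<noteq> u" "v \<noteq> u" "a \<noteq> w" "b \<noteq> w" "d \<noteq> w" "v \<noteq> w"
    "a \<noteq> y" "b \<noteq> y" "d \<noteq> y" "v \<noteq> y" "a \<noteq> z" "b \<noteq> z" "d \<noteq> z" "v \<noteq> z"
    using abd(1-3) v(1) by auto
  note sy = v(2)[THEN arcs_symmetric] assms(5,6)[THEN arcs_symmetric]
  show False
  proof (cases "v = d")
    case True
    then show False
      using not_disjoint_cycles[of "[u, a, w, b]" "[w, y, z, v]"] abd v assms(5,6) adj_u ne ne' sy
      by (auto simp: cycle_arcs_def)
  next
    case False
    then show False
      using not_disjoint_cycles[of "[u, a, w, b]" "[w, y, z, v, u, d]"] abd v assms(5,6) adj_u ne ne' sy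
      by (auto simp: cycle_arcs_def)
  qed
qed

end

section \<open>The extremal graph\<close>

lemma image_offdiagonal:
  assumes "inj_on f X"
  shows "map_prod f f ` {(x, y). x \<in> X \<and> y \<in> X \<and> x \<noteq> y} = {(x, y). x \<in> f ` X \<and> y \<in> f ` X \<and> x \<noteq> y}"
proof (intro equalityI subsetI)
  fix e assume "e \<in> map_prod f f ` {(x, y). x \<in> X \<and> y \<in> X \<and> x \<noteq> y}"
  then obtain x y where "e = (f x, f y)" "x \<in> X" "y \<in> X" "x \<noteq> y" by auto
  then show "e \<in> {(x, y). x \<in> f ` X \<and> y \<in> f ` X \<and> x \<noteq> y}"
    using assms by (auto simp: inj_on_eq_iff)
next
  fix e assume "e \<in> {(x, y). x \<in> f ` X \<and> y \<in> f ` X \<and> x \<noteq> y}"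
  then obtain x y where "e = map_prod f f (x, y)" "x \<in> X" "y \<in> X" "x \<noteq> y" by auto
  then show "e \<in> map_prod f f ` {(x, y). x \<in> X \<and> y \<in> X \<and> x \<noteq> y}" by blast
qed

lemma graph_isomorphic_K4_bullet_star:
  assumes "pair_graph G" "card (pverts G) = n"
    and X: "X = {u, a, b, d}" "card X = 4" and V: "pverts G = X \<union> R" "X \<inter> R = {}"
    and arcs: "parcs G = {(x, y). x \<in> X \<and> y \<in> X \<and> x \<noteq> y} \<union> {u} \<times> R \<union> R \<times> {u}"
  shows "graph_isomorphic G (K4_bullet_star n)"
proof -
  interpret pair_graph G by fact
  have "finite R" using pair_finite_verts V(1) by simp
  have "card R = n - 4"
  proof -
    have "finite X" by (simp add: X(1))
    then show ?thesis using assms(2) V \<open>finite R\<close> X(2) by (simp add: card_Un_disjoint)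
  qed
  then obtain h where h: "bij_betw h R {..<n - 4}"
    using ex_bij_betw_finite_nat[OF \<open>finite R\<close>] by (auto simp: lessThan_atLeast0)
  have "distinct [u, a, b, d]"
    using X by (intro card_distinct) simp
  then have ne: "u \<noteq> a" "u \<noteq> b" "u \<noteq> d" "a \<noteq> b" "a \<noteq> d" "b \<noteq> d" by auto
  \<comment> \<open>The centre \<open>u\<close> goes to the identified vertex \<open>Inl 0\<close>,
    and \<open>h\<close> numbers the pendant vertices.\<close>
  define f :: "'a \<Rightarrow> nat + (nat + nat)" where
    "f x = (if x = u then Inl 0 else if x = a then Inl 1 else if x = b then Inl 2
      else if x = d then Inl 3 else Inr (Inr (h x)))" for x
  have fX: "f u = Inl 0" "f a = Inl 1" "f b = Inl 2" "f d = Inl 3"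
    using ne by (auto simp: f_def)
  have fR: "f x = Inr (Inr (h x))" if "x \<in> R" for x
    using that V(2) X(1) by (auto simp: f_def)
  have imX: "f ` X = Inl ` {0, 1, 2, 3}" by (simp add: X(1) fX)
  have "f ` R = (\<lambda>j. Inr (Inr j)) ` h ` R"
    unfolding image_image using fR by (intro image_cong refl)
  then have imR: "f ` R = (\<lambda>j. Inr (Inr j)) ` {..<n - 4}"
    using h by (simp add: bij_betw_def)
  have injX: "inj_on f X" by (simp add: inj_on_def X(1) fX)
  have "inj_on f R"
    using h fR by (auto simp: bij_betw_def inj_on_def)
  moreover have "f ` X \<inter> f ` R = {}"
    unfolding imX imR by auto
  ultimately have "inj_on f (pverts G)"
    unfolding V(1) inj_on_Un using injX by blast
  moreover have "pverts (K4_bullet_star n) = f ` pverts G"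
    by (simp only: pverts_K4_bullet_star V(1) image_Un imX imR)
  moreover have "parcs (K4_bullet_star n) = map_prod f f ` parcs G"
  proof -
    have "map_prod f f ` ({u} \<times> R) = {f u} \<times> f ` R" "map_prod f f ` (R \<times> {u}) = f ` R \<times> {f u}"
      by (rule map_prod_surj_on; simp)+
    moreover have "{(Inl i, Inl j) | i j. i \<in> {0, 1, 2, 3} \<and> j \<in> {0, 1, 2, 3} \<and> i \<noteq> j} =
        {(x, y). x \<in> f ` X \<and> y \<in> f ` X \<and> x \<noteq> y}"
      unfolding imX by blast
    moreover have "{(Inl 0, Inr (Inr j)) | j. j < n - 4} = {f u} \<times> f ` R"
      "{(Inr (Inr j), Inl 0) | j. j < n - 4} = f ` R \<times> {f u}"
      unfolding imR fX(1) by auto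
    ultimately show ?thesis
      unfolding parcs_K4_bullet_star arcs image_Un image_offdiagonal[OF injX] by (simp only:)
  qed
  ultimately show ?thesis unfolding graph_isomorphic_iff[OF assms(1)] by blast
qed

section \<open>Weighted walks from \<open>u\<close>\<close>

context rooted_no_edge_disjoint_cycles
begin

text \<open>The absolute value of an eigenvector satisfies the eigenvalue equation only as an
  inequality, by the triangle inequality.\<close>

context
  fixes g :: "'a \<Rightarrow> real" and k :: real
  assumes g: "\<And>v. v \<in> pverts G \<Longrightarrow> 0 \<le> g v" "\<And>v. v \<in> pverts G \<Longrightarrow> g v \<le> 1" "g u = 1"
    and sub: "\<And>v. v \<in> pverts G \<Longrightarrow> k * g v \<le> (\<Sum>y\<in>E `` {v}. g y)"
    and k_gt: "4 < k"
begin

lemma NW_verts: "v \<in> N \<Longrightarrow> v \<in> pverts G" "w \<in> W \<Longrightarrow> w \<in> pverts G"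
  using N_subset by (auto simp: W_def)

lemma nbrs_split: "E `` {v} = (E `` {v} \<inter> {u}) \<union> ((E `` {v} \<inter> N) \<union> (E `` {v} \<inter> W))"
  by (auto simp: W_def dest: in_arcsD2)

lemma sum_nbrs_split:
  "(\<Sum>y\<in>E `` {v}. g y) = (\<Sum>y\<in>E `` {v} \<inter> {u}. g y) + ((\<Sum>y\<in>E `` {v} \<inter> N. g y) + (\<Sum>y\<in>E `` {v} \<inter> W. g y))"
proof -
  have "u \<notin> N" "u \<notin> W" "N \<inter> W = {}" using N_subset by (auto simp: W_def)
  then have d: "(E `` {v} \<inter> {u}) \<inter> ((E `` {v} \<inter> N) \<union> (E `` {v} \<inter> W)) = {}"
    "(E `` {v} \<inter> N) \<inter> (E `` {v} \<inter> W) = {}" by auto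
  have "(\<Sum>y\<in>E `` {v}. g y) = sum g ((E `` {v} \<inter> {u}) \<union> ((E `` {v} \<inter> N) \<union> (E `` {v} \<inter> W)))"
    by (subst nbrs_split) simp
  also have "\<dots> = sum g (E `` {v} \<inter> {u}) + sum g ((E `` {v} \<inter> N) \<union> (E `` {v} \<inter> W))"
    by (rule sum.union_disjoint) (use d finite_N finite_W in auto)
  also have "sum g ((E `` {v} \<inter> N) \<union> (E `` {v} \<inter> W)) = sum g (E `` {v} \<inter> N) + sum g (E `` {v} \<inter> W)"
    by (rule sum.union_disjoint) (use d finite_N finite_W in auto)
  finally show ?thesis .
qed

lemma sub_N: "v \<in> N \<Longrightarrow> k * g v \<le> 1 + (\<Sum>y\<in>E `` {v} \<inter> N. g y) + (\<Sum>y\<in>E `` {v} \<inter> W. g y)"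
  using sub[OF NW_verts(1), of v] adj_u(2)[of v] g(3) unfolding sum_nbrs_split by simp

lemma sub_W: "w \<in> W \<Longrightarrow> k * g w \<le> real (c w) + real (deg_in E W w)"
proof -
  assume w: "w \<in> W"
  have "(\<Sum>y\<in>E `` {w} \<inter> N. g y) \<le> real (c w) * 1" "(\<Sum>y\<in>E `` {w} \<inter> W. g y) \<le> real (deg_in E W w) * 1"
    unfolding c_def by (rule sum_nbrs_le_deg_in; use g(2) NW_verts in blast)+
  then show ?thesis
    using sub[OF NW_verts(2)[OF w]] not_adj_u[OF w] unfolding sum_nbrs_split by simp
qed

text \<open>\<open>P\<close> and \<open>Q\<close> are the weights of the 2-walks from
  \<open>u\<close> that end in \<open>N\<close> and in \<open>W\<close>.\<close>

abbreviation (input) P :: real where "P \<equiv> \<Sum>v\<in>N. real (deg_in E N v) * g v"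
abbreviation (input) Q :: real where "Q \<equiv> \<Sum>w\<in>W. real (c w) * g w"

text \<open>Apply \<open>sub\<close> at \<open>u\<close> and then at its neighbours;
  \<open>card N\<close> of the 2-walks return to \<open>u\<close>, where the weight is 1.\<close>

lemma k_sq_le: "k\<^sup>2 \<le> real (card N) + P + Q"
proof -
  have "k * 1 \<le> (\<Sum>v\<in>N. g v)"
    using sub[OF u] g(3) by (simp add: N_def)
  then have "k * k \<le> k * (\<Sum>v\<in>N. g v)" using k_gt by (intro mult_left_mono) auto
  also have "\<dots> \<le> (\<Sum>v\<in>N. 1 + (\<Sum>y\<in>E `` {v} \<inter> N. g y) + (\<Sum>y\<in>E `` {v} \<inter> W. g y))"
    unfolding sum_distrib_left by (rule sum_mono) (rule sub_N)
  also have "\<dots> = real (card N) + P + Q"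
    using sum_nbrs_swap[OF sym_parcs finite_N finite_N, of "\<lambda>_. 1" g]
      sum_nbrs_swap[OF sym_parcs finite_N finite_W, of "\<lambda>_. 1" g]
    by (simp add: sum.distrib deg_in_def c_def)
  finally show ?thesis by (simp add: power2_eq_square)
qed

text \<open>A further application of \<open>sub\<close> to the end vertices of the 2-walks bounds
  \<open>k * P\<close> and \<open>k * Q\<close>. Walks inside \<open>N\<close> extend in at most
  \<open>\<Delta>\<close> ways, so \<open>P\<close> reappears with factor \<open>\<Delta>\<close>
  and is absorbed on the left.\<close>

lemma spectral_inequality:
  assumes \<Delta>: "\<And>v. v \<in> N \<Longrightarrow> deg_in E N v \<le> \<Delta>" "real \<Delta> < k"
  shows "(k - \<Delta>) * k\<^sup>2 \<le> (k - \<Delta>) * real (card N) +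
    (\<Sum>w\<in>W. real (c w) * (real (c w) + real (deg_in E W w))) + real nbr_arcs"
proof -
  have dd: "(\<Sum>v\<in>E `` {y} \<inter> N. real (deg_in E N v)) \<le> real (deg_in E N y) * real \<Delta>" for y
    by (rule sum_nbrs_le_deg_in) (use \<Delta>(1) in auto)
  have "k * P = (\<Sum>v\<in>N. real (deg_in E N v) * (k * g v))"
    by (simp add: sum_distrib_left mult_ac)
  also have "\<dots> \<le> (\<Sum>v\<in>N. real (deg_in E N v) *
      (1 + (\<Sum>y\<in>E `` {v} \<inter> N. g y) + (\<Sum>y\<in>E `` {v} \<inter> W. g y)))"
    by (intro sum_mono mult_left_mono sub_N) auto
  also have "\<dots> = real nbr_arcs + (\<Sum>y\<in>N. (\<Sum>v\<in>E `` {y} \<inter> N. real (deg_in E N v)) * g y) +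
      (\<Sum>y\<in>W. (\<Sum>v\<in>E `` {y} \<inter> N. real (deg_in E N v)) * g y)"
    unfolding distrib_left sum.distrib sum_nbrs_swap[OF sym_parcs finite_N finite_N]
      sum_nbrs_swap[OF sym_parcs finite_N finite_W]
    by (simp add: nbr_arcs_def)
  also have "(\<Sum>y\<in>N. (\<Sum>v\<in>E `` {y} \<inter> N. real (deg_in E N v)) * g y) \<le> (\<Sum>y\<in>N. real (deg_in E N y) * real \<Delta> * g y)"
    by (intro sum_mono mult_right_mono dd g(1) NW_verts(1))
  also have "(\<Sum>y\<in>W. (\<Sum>v\<in>E `` {y} \<inter> N. real (deg_in E N v)) * g y) \<le> (\<Sum>y\<in>W. real (deg_in E N y) * real \<Delta> * g y)"
    by (intro sum_mono mult_right_mono dd g(1) NW_verts(2))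
  finally have kP: "k * P \<le> real nbr_arcs + real \<Delta> * P + real \<Delta> * Q"
    by (simp add: sum_distrib_left mult_ac c_def)
  have "k * Q = (\<Sum>w\<in>W. real (c w) * (k * g w))"
    by (simp add: sum_distrib_left mult_ac)
  also have "\<dots> \<le> (\<Sum>w\<in>W. real (c w) * (real (c w) + real (deg_in E W w)))"
    by (intro sum_mono mult_left_mono sub_W) auto
  finally have kQ: "k * Q \<le> (\<Sum>w\<in>W. real (c w) * (real (c w) + real (deg_in E W w)))" .
  \<comment> \<open>By \<open>kP\<close>, \<open>(k - \<Delta>) * P\<close> is at most
    \<open>nbr_arcs + \<Delta> * Q\<close>; the last term completes
    \<open>(k - \<Delta>) * Q\<close> to \<open>k * Q\<close>.\<close>
  have "(k - \<Delta>) * k\<^sup>2 \<le> (k - \<Delta>) * (real (card N) + P + Q)"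
    using k_sq_le \<Delta>(2) by (intro mult_left_mono) auto
  then show ?thesis using kP kQ by (simp add: algebra_simps)
qed

text \<open>Applied with \<open>m = 4 - \<Delta>\<close>, so that after moving
  \<open>(k - \<Delta>) * card W\<close> to the left, \<open>card W\<close> keeps the negative
  coefficient \<open>4 - k\<close>.\<close>

lemma spectral_inequality_cost:
  assumes "\<And>v. v \<in> N \<Longrightarrow> deg_in E N v \<le> \<Delta>" "real \<Delta> < k"
  shows "(k - \<Delta>) * k\<^sup>2 \<le> (k - \<Delta>) * real (card N) +
    (cost E c m W + m * real (card W)) + real nbr_arcs"
  using spectral_inequality[OF assms] unfolding cost_eq by simp

section \<open>Excluding all neighbourhoods but the extremal one\<close>

context
  assumes k_large: "6 \<le> (k - 2) * (k\<^sup>2 - (real (card (pverts G)) - 1))"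
begin

text \<open>This is \<open>k\<^sup>2 - (n - 1)\<close> for \<open>n\<close> vertices. Each case
  below plays an upper bound on it against \<open>gap_ge\<close>.\<close>

definition gap :: real where "gap = k\<^sup>2 - real (card N) - real (card W)"

lemma gap_ge: "6 \<le> (k - 2) * gap"
  using k_large by (simp add: gap_def card_pverts algebra_simps)

lemma nbr_arcs_eq_card: "nbr_arcs = card (E \<inter> N \<times> N)"
  by (simp add: nbr_arcs_def card_Restr_eq_sum_deg_in[OF finite_N])

text \<open>If no vertex of \<open>W\<close> has two neighbours in \<open>N\<close>, then
  \<open>gap \<le> 0\<close> at once. Otherwise \<open>u\<close> lies on a 4-cycle, and the excess
  is at most 8.\<close>

lemma not_N_independent: "\<exists>v\<in>N. deg_in E N v \<noteq> 0"
proof (rule ccontr)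
  assume "\<not> ?thesis"
  then have d0: "deg_in E N v = 0" if "v \<in> N" for v using that by blast
  have n0: "nbr_arcs = 0" using d0 by (simp add: nbr_arcs_def)
  have "0 < (k - 2) * gap" using gap_ge by linarith
  then have gap_pos: "0 < gap" using k_gt by (simp add: zero_less_mult_iff)
  show False
  proof (cases "\<forall>w\<in>W. c w \<le> 1")
    case True
    have "Q \<le> (\<Sum>w\<in>W. 1 * 1)"
      using True g NW_verts(2) by (intro sum_mono mult_mono) auto
    moreover have "P = 0" using d0 by simp
    ultimately show False using k_sq_le gap_pos by (simp add: gap_def)
  next
    case False
    then obtain w where w: "w \<in> W" "2 \<le> c w" by force
    then obtain B where B: "B \<subseteq> N" "card B = 2" "\<And>b. b \<in> B \<Longrightarrow> (w, b) \<in> E"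
      using obtain_c_nbrs[of 2 w] by auto
    then obtain a b where ab: "B = {a, b}" "a \<noteq> b" by (auto simp: card_2_iff)
    have "a \<in> N" "b \<in> N" "(w, a) \<in> E" "(w, b) \<in> E" using B ab by auto
    moreover have "u \<notin> N" "w \<notin> N" "u \<noteq> w" using w(1) N_subset by (auto simp: W_def)
    ultimately have "distinct [u, a, w, b]" "set (cycle_arcs [u, a, w, b]) \<subseteq> E"
      using ab(2) adj_u arcs_symmetric[of w a] by (auto simp: cycle_arcs_def)
    then have "real nbr_arcs + excess E c S \<le> 8" if "S \<subseteq> W" for S
      using nbr_arcs_plus_excess_le[of "[u, a, w, b]", OF _ _ _ that] by simp
    then have "excess E c S \<le> 8" if "S \<subseteq> W" for S
      using that n0 by simp
    then have "cost E c 4 W \<le> 10"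
      by (rule cost_le_of_excess_le_8[OF finite_W sym_parcs irrefl_E _ c_le_3
            c_eq_0_if_adj_c_eq_3 c_eq_0_if_dist_2_c_eq_3])
    then have "k * k\<^sup>2 \<le> k * real (card N) + (10 + 4 * real (card W))"
      using spectral_inequality_cost[of 0 4] d0 n0 k_gt by simp
    then have "k * gap \<le> 10 + (4 - k) * real (card W)"
      by (simp add: gap_def algebra_simps)
    also have "\<dots> \<le> 10 + (4 - k) * 1"
    proof -
      have "W \<noteq> {}" using w(1) by auto
      then have "1 \<le> real (card W)" using finite_W by (simp add: Suc_le_eq card_gt_0_iff)
      then show ?thesis using k_gt by (intro add_left_mono mult_left_mono_neg) auto
    qed
    finally have "k * gap \<le> 14 - k" by simp
    then have "(k - 2) * (k * gap) \<le> (k - 2) * (14 - k)" using k_gt by (intro mult_left_mono) auto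
    moreover have "k * 6 \<le> k * ((k - 2) * gap)" using gap_ge k_gt by (intro mult_left_mono) auto
    \<comment> \<open>Eliminating \<open>gap\<close> leaves
      \<open>6 * k \<le> (k - 2) * (14 - k)\<close>, which has no real solution.\<close>
    ultimately have "(k - 5)\<^sup>2 + 3 \<le> 0" by (simp add: algebra_simps power2_eq_square)
    then show False using zero_le_power2[of "k - 5"] by linarith
  qed
qed

lemma triangle_excess_le:
  assumes "a \<in> N" "b \<in> N" "(a, b) \<in> E" "S \<subseteq> W"
  shows "excess E c S \<le> 6 - real nbr_arcs"
proof -
  have "u \<notin> N" "a \<noteq> b" using N_subset no_loops'[OF assms(3)] by auto
  then have "distinct [u, a, b]" "set (cycle_arcs [u, a, b]) \<subseteq> E"
    using assms adj_u by (auto simp: cycle_arcs_def)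
  then show ?thesis
    using nbr_arcs_plus_excess_le[of "[u, a, b]", OF _ _ _ assms(4)] by simp
qed

text \<open>Otherwise the edges inside \<open>N\<close> form a matching; as they pairwise meet,
  there is exactly one. So \<open>nbr_arcs = 2\<close>, and the triangle over that edge leaves
  excess at most 4.\<close>

lemma exists_N_degree_2: "\<exists>v\<in>N. 2 \<le> deg_in E N v"
proof (rule ccontr)
  assume "\<not> ?thesis"
  then have d1: "deg_in E N v \<le> 1" if "v \<in> N" for v using that by force
  obtain a b where ab: "a \<in> N" "b \<in> N" "(a, b) \<in> E"
    using not_N_independent by (auto simp: deg_in_def finite_N)
  note ba = arcs_symmetric[OF ab(3)]
  have "a \<noteq> b" using no_loops'[OF ab(3)] .
  have unique: "y = z" if "x \<in> N" "y \<in> N" "z \<in> N" "(x, y) \<in> E" "(x, z) \<in> E" for x y z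
  proof -
    have "card {y, z} \<le> deg_in E N x"
      unfolding deg_in_def using that finite_N by (intro card_mono) auto
    then show ?thesis using d1[OF that(1)] by (cases "y = z") auto
  qed
  have "E \<inter> N \<times> N = {(a, b), (b, a)}"
  proof (intro equalityI subsetI)
    fix e assume "e \<in> E \<inter> N \<times> N"
    then obtain x y where e: "e = (x, y)" "x \<in> N" "y \<in> N" "(x, y) \<in> E" by auto
    note yx = arcs_symmetric[OF e(4)]
    have "x \<in> {a, b} \<or> y \<in> {a, b}"
      using N_edges_intersect[OF ab(1,2) e(2,3) ab(3) e(4)] by auto
    then consider "x = a" | "x = b" | "y = a" | "y = b" by auto
    then have "x = a \<and> y = b \<or> x = b \<and> y = a"
    proof cases
      case 1
      then show ?thesis using unique[OF ab(1) e(3) ab(2) _ ab(3)] e(4) by simp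
    next
      case 2
      then show ?thesis using unique[OF ab(2) e(3) ab(1) _ ba] e(4) by simp
    next
      case 3
      then show ?thesis using unique[OF ab(1) e(2) ab(2) _ ab(3)] yx by simp
    next
      case 4
      then show ?thesis using unique[OF ab(2) e(2) ab(1) _ ba] yx by simp
    qed
    then show "e \<in> {(a, b), (b, a)}" using e(1) by auto
  qed (use ab ba in auto)
  then have n2: "nbr_arcs = 2" using \<open>a \<noteq> b\<close> by (simp add: nbr_arcs_eq_card)
  have "cost E c 3 W \<le> 6"
    using triangle_excess_le[OF ab] n2
    by (intro cost_le_of_excess_le_4[OF finite_W sym_parcs irrefl_E]) auto
  then have le: "(k - 1) * k\<^sup>2 \<le> (k - 1) * real (card N) + (6 + 3 * real (card W)) + 2"
    using spectral_inequality_cost[of 1 3] d1 n2 k_gt by simp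
  have "W = {} \<Longrightarrow> cost E c 3 W = 0" by (simp add: cost_def)
  then have W0: "W = {} \<Longrightarrow> (k - 1) * k\<^sup>2 \<le> (k - 1) * real (card N) + 2"
    using spectral_inequality_cost[of 1 3] d1 n2 k_gt by simp
  have "(k - 1) * gap \<le> 12 - k"
  proof (cases "W = {}")
    \<comment> \<open>This case is void: cost 0 gives at most 2, while \<open>gap_ge\<close> gives
      at least 6.\<close>
    case True
    then have "(k - 1) * gap \<le> 2" using W0 by (simp add: gap_def algebra_simps)
    moreover have "6 * 1 \<le> (k - 1) * gap"
      using gap_ge k_gt by (smt (verit) mult_right_mono zero_less_mult_iff)
    ultimately show ?thesis by simp
  next
    case False
    have "(k - 1) * gap \<le> 8 + (4 - k) * real (card W)"
      using le by (simp add: gap_def algebra_simps)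
    also have "\<dots> \<le> 8 + (4 - k) * 1"
    proof -
      have "1 \<le> real (card W)" using finite_W False by (simp add: Suc_le_eq card_gt_0_iff)
      then show ?thesis using k_gt by (intro add_left_mono mult_left_mono_neg) auto
    qed
    finally show ?thesis by simp
  qed
  then have "(k - 2) * ((k - 1) * gap) \<le> (k - 2) * (12 - k)" using k_gt by (intro mult_left_mono) auto
  moreover have "(k - 1) * 6 \<le> (k - 1) * ((k - 2) * gap)" using gap_ge k_gt by (intro mult_left_mono) auto
  \<comment> \<open>Eliminating \<open>gap\<close> leaves
    \<open>6 * (k - 1) \<le> (k - 2) * (12 - k)\<close>, again without real solution.\<close>
  ultimately have "(k - 4)\<^sup>2 + 2 \<le> 0" by (simp add: algebra_simps power2_eq_square)
  then show False using zero_le_power2[of "k - 4"] by linarith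
qed

text \<open>A vertex of degree 2 inside \<open>N\<close> gives \<open>4 \<le> nbr_arcs\<close>. The
  cost bound \<open>6 - nbr_arcs\<close> then cancels the term \<open>nbr_arcs\<close>, and
  \<open>6 \<le> (k - 2) * gap \<le> 6 + (4 - k) * card W\<close> empties \<open>W\<close>.\<close>

lemma extremal_structure:
  obtains a b d where "a \<in> N" "b \<in> N" "d \<in> N" "a \<noteq> b" "a \<noteq> d" "b \<noteq> d" "W = {}"
    "E \<inter> N \<times> N = {(x, y). x \<in> {a, b, d} \<and> y \<in> {a, b, d} \<and> x \<noteq> y}"
proof -
  obtain b where b: "b \<in> N" "2 \<le> deg_in E N b" using exists_N_degree_2 by blast
  then obtain B where B: "B \<subseteq> E `` {b} \<inter> N" "card B = 2"
    unfolding deg_in_def using obtain_subset_with_card_n by metis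
  then obtain a d where eq: "B = {a, d}" "a \<noteq> d" by (auto simp: card_2_iff)
  have ad: "a \<in> N" "d \<in> N" "(b, a) \<in> E" "(b, d) \<in> E" using B eq by auto
  note sy = ad(3,4)[THEN arcs_symmetric]
  have ne: "b \<noteq> a" "b \<noteq> d" using ad(3,4)[THEN no_loops'] by auto
  let ?F = "{(a, b), (b, a), (b, d), (d, b)}"
  have F: "?F \<subseteq> E \<inter> N \<times> N" using ad sy b by auto
  have finE: "finite (E \<inter> N \<times> N)" using finite_N by simp
  have cF: "card ?F = 4" using ne eq by auto
  then have n4: "4 \<le> nbr_arcs" using card_mono[OF finE F] by (simp add: nbr_arcs_eq_card)
  have ex: "excess E c S \<le> 6 - real nbr_arcs" if "S \<subseteq> W" for S
    using triangle_excess_le[OF ad(1) b(1) sy(1) that] .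
  have n6: "nbr_arcs \<le> 6" using ex[of "{}"] by (simp add: excess_def)
  have "cost E c 2 W \<le> 6 - real nbr_arcs"
    using n4 ex by (intro cost_le_of_excess_le_2[OF finite_W sym_parcs irrefl_E]) auto
  then have "(k - 2) * k\<^sup>2 \<le> (k - 2) * real (card N) + 6 + 2 * real (card W)"
    using spectral_inequality_cost[of 2 2] deg_N_le_2 k_gt by simp
  then have "(k - 2) * gap \<le> 6 + (4 - k) * real (card W)"
    by (simp add: gap_def algebra_simps)
  then have "0 \<le> (4 - k) * real (card W)" using gap_ge by simp
  then have "card W = 0" using k_gt by (simp add: zero_le_mult_iff)
  then have W0: "W = {}" using finite_W by simp
  \<comment> \<open>With \<open>W\<close> empty the cost drops out, and
    \<open>6 \<le> (k - 2) * gap \<le> nbr_arcs \<le> 6\<close> forces a third edge inside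
    \<open>N\<close>.\<close>
  then have "(k - 2) * k\<^sup>2 \<le> (k - 2) * real (card N) + real nbr_arcs"
    using spectral_inequality[of 2] deg_N_le_2 k_gt by simp
  then have "(k - 2) * gap \<le> real nbr_arcs" using W0 by (simp add: gap_def algebra_simps)
  then have n: "nbr_arcs = 6" using gap_ge n6 by simp
  then have "\<not> E \<inter> N \<times> N \<subseteq> ?F"
    using card_mono[of ?F "E \<inter> N \<times> N"] cF by (auto simp: nbr_arcs_eq_card)
  then obtain x y where xy: "x \<in> N" "y \<in> N" "(x, y) \<in> E" "(x, y) \<notin> ?F" by auto
  have b2: "z \<in> {a, d}" if "z \<in> N" "(b, z) \<in> E" for z
  proof (rule ccontr)
    assume "z \<notin> {a, d}"
    then have "card {z, a, d} = 3" using eq by simp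
    moreover have "card {z, a, d} \<le> deg_in E N b"
      unfolding deg_in_def using that ad finite_N by (intro card_mono) auto
    ultimately show False using deg_N_le_2[OF b(1)] by simp
  qed
  \<comment> \<open>\<open>b\<close> already has its two neighbours, so the new edge avoids
    \<open>b\<close>; meeting both edges at \<open>b\<close>, it joins \<open>a\<close> and
    \<open>d\<close>.\<close>
  have "x \<noteq> b" "y \<noteq> b" using b2[of y] b2[of x] xy arcs_symmetric[of x b] by auto
  moreover have "{a, b} \<inter> {x, y} \<noteq> {}" "{b, d} \<inter> {x, y} \<noteq> {}"
    using N_edges_intersect[OF ad(1) b(1) xy(1,2) sy(1) xy(3)]
      N_edges_intersect[OF b(1) ad(2) xy(1,2) ad(4) xy(3)] by auto
  ultimately have "{x, y} = {a, d}" using eq by auto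
  then have "(a, d) \<in> E" "(d, a) \<in> E" using xy(3) arcs_symmetric[OF xy(3)]
    by (auto simp: doubleton_eq_iff)
  let ?T = "{(x, y). x \<in> {a, b, d} \<and> y \<in> {a, b, d} \<and> x \<noteq> y}"
  have T: "?T = {(a, b), (b, a), (b, d), (d, b), (a, d), (d, a)}" using ne eq by auto
  have "?T \<subseteq> E \<inter> N \<times> N" unfolding T using F \<open>(a, d) \<in> E\<close> \<open>(d, a) \<in> E\<close> ad by auto
  moreover have "card ?T = 6" unfolding T using ne eq by auto
  ultimately have "?T = E \<inter> N \<times> N"
    using n finE by (intro card_subset_eq) (auto simp: nbr_arcs_eq_card)
  then show ?thesis using that[of a b d] ad b ne eq W0 by auto
qed

lemma isomorphic_K4_bullet_star: "graph_isomorphic G (K4_bullet_star (card (pverts G)))"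
proof -
  obtain a b d where abd: "a \<in> N" "b \<in> N" "d \<in> N" "a \<noteq> b" "a \<noteq> d" "b \<noteq> d" "W = {}"
    "E \<inter> N \<times> N = {(x, y). x \<in> {a, b, d} \<and> y \<in> {a, b, d} \<and> x \<noteq> y}"
    by (rule extremal_structure)
  let ?X = "{u, a, b, d}" and ?R = "N - {a, b, d}"
  have uN: "u \<notin> N" using N_subset by auto
  have V: "pverts G = insert u N" using abd(7) N_subset u by (auto simp: W_def)
  have "E = {u} \<times> N \<union> N \<times> {u} \<union> (E \<inter> N \<times> N)"
  proof (intro equalityI subsetI)
    fix e assume e: "e \<in> E"
    then obtain x y where xy: "e = (x, y)" "x \<in> insert u N" "y \<in> insert u N"
      using V in_arcsD1 in_arcsD2 by (metis surj_pair)
    moreover have "x \<noteq> y" using e xy no_loops' by auto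
    ultimately show "e \<in> {u} \<times> N \<union> N \<times> {u} \<union> (E \<inter> N \<times> N)" using e by auto
  qed (use adj_u in auto)
  then have arcs: "E = {u} \<times> N \<union> N \<times> {u} \<union> {(x, y). x \<in> {a, b, d} \<and> y \<in> {a, b, d} \<and> x \<noteq> y}"
    unfolding abd(8) .
  have "u \<noteq> a" "u \<noteq> b" "u \<noteq> d" using uN abd(1-3) by auto
  then have "card ?X = 4" using abd(4-6) by simp
  moreover have "pverts G = ?X \<union> ?R" "?X \<inter> ?R = {}" using V uN abd(1-3) by auto
  moreover have "E = {(x, y). x \<in> ?X \<and> y \<in> ?X \<and> x \<noteq> y} \<union> {u} \<times> ?R \<union> ?R \<times> {u}"
    unfolding arcs using \<open>u \<noteq> a\<close> \<open>u \<noteq> b\<close> \<open>u \<noteq> d\<close> abd(1-3) by auto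
  ultimately show ?thesis
    by (intro graph_isomorphic_K4_bullet_star[OF pair_graph refl refl])
qed

end

end

end

section \<open>Normalising an eigenvector at an entry of maximal modulus\<close>

theorem theorem3:
  fixes G :: "'a pair_pre_digraph" and n :: nat
  assumes "pair_graph G"
    and "card (pverts G) = n"
    and "n \<ge> 17"
    and "graph_spectral_radius G \<ge> graph_spectral_radius (K4_bullet_star n)"
    and "\<not> graph_isomorphic G (K4_bullet_star n)"
  shows "has_two_edge_disjoint_cycles G"
proof (rule ccontr)
  assume no_two: "\<not> has_two_edge_disjoint_cycles G"
  interpret pair_graph G by fact
  let ?k = "graph_spectral_radius G"
  have "pverts G \<noteq> {}" using assms(2,3) by auto
  from graph_spectral_radius_eigenfunction[OF this]
  obtain f where f: "\<exists>v\<in>pverts G. f v \<noteq> 0"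
    and eig: "\<And>v. v \<in> pverts G \<Longrightarrow> (\<Sum>y\<in>parcs G `` {v}. f y) = ?k * f v"
    by blast
  have k: "4 < ?k" "6 \<le> (?k - 2) * (?k\<^sup>2 - (real n - 1))"
    using spectral_radius_K4_bullet_star_lower[OF assms(3,4)] by auto
  obtain u where u: "u \<in> pverts G" and max: "\<And>v. v \<in> pverts G \<Longrightarrow> \<bar>f v\<bar> \<le> \<bar>f u\<bar>"
  proof -
    have "Max ((\<lambda>v. \<bar>f v\<bar>) ` pverts G) \<in> (\<lambda>v. \<bar>f v\<bar>) ` pverts G"
      using \<open>pverts G \<noteq> {}\<close> by (intro Max_in) auto
    then obtain u where "u \<in> pverts G" "Max ((\<lambda>v. \<bar>f v\<bar>) ` pverts G) = \<bar>f u\<bar>" by auto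
    then show ?thesis using that[of u] by (metis Max_ge finite_imageI imageI pair_finite_verts)
  qed
  have fu: "0 < \<bar>f u\<bar>" using f max by force
  interpret rooted_no_edge_disjoint_cycles G u
    by unfold_locales (use no_two u in auto)
  have "graph_isomorphic G (K4_bullet_star (card (pverts G)))"
  proof (rule isomorphic_K4_bullet_star[of "\<lambda>v. \<bar>f v\<bar> / \<bar>f u\<bar>" ?k])
    fix v assume v: "v \<in> pverts G"
    show "\<bar>f v\<bar> / \<bar>f u\<bar> \<le> 1" using max[OF v] fu by simp
    have "?k * \<bar>f v\<bar> = \<bar>\<Sum>y\<in>parcs G `` {v}. f y\<bar>"
      using eig[OF v] k(1) by (simp add: abs_mult)
    also have "\<dots> \<le> (\<Sum>y\<in>parcs G `` {v}. \<bar>f y\<bar>)" by (rule sum_abs)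
    finally show "?k * (\<bar>f v\<bar> / \<bar>f u\<bar>) \<le> (\<Sum>y\<in>parcs G `` {v}. \<bar>f y\<bar> / \<bar>f u\<bar>)"
      using fu by (simp add: sum_divide_distrib[symmetric] divide_right_mono)
  qed (use fu k assms(2) in auto)
  then show False using assms(2,5) by simp
qed

end
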